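(* Suppose that the fibre metric $g_v$ is Lorentzian. Let $X$ be a given null geodesic in $M$ that is future complete, i.e. its affine parameter ranges to $+\infty$. Suppose that everywhere along $X$ the positive energy condition $\operatorname{tr}S^\sharp\le0$ holds. Suppose that there is a Sachs section $s$, defined in a neighborhood of $X$, such that $X$ is a member of the congruence (the integral curves of the associated vector field $k$). Then the divergence $\theta$ of the congruence is everywhere non-negative along $X$.
   Context: Let $M$ be a smooth manifold of dimension $n\ge 3$, and $TM'$ its tangent bundle with the zero section removed, with local coordinates $(x^i,v^i)$ induced from coordinates $x^i$ on $M$. Let $VTM'=\ker d\pi_{TM'}$ be the vertical bundle, where $\pi_{TM'}:TM'\to M$, and $V^0TM'\subset T^*TM'$ its annihilator. Let $\lambda=dx^i\otimes\frac{\partial}{\partial v^i}\in\Gamma(\operatorname{End}(TTM'))$, with image and kernel $VTM'$, and let $\overline\lambda:\pi_{TM'}^{-1}TM\to VTM'$ be the isomorphism $\overline\lambda(\partial/\partial x^i)=\partial/\partial v^i$. For a function $f$ let $Df=\frac{\partial f}{\partial v^i}dx^i$. Let $\mathscr{H}\subset TM'$ be a smooth hypersurface, invariant under the scalings $(x,v)\mapsto(x,sv)$, $s>0$, projecting onto $M$ and meeting each fibre of $TM'$ in a smooth hypersurface of the fibre, given by $G=0$ where $G$ is a smooth function on an open scaling-invariant neighborhood of $\mathscr{H}$ in $TM'$ (over which we work) such that $DG\ne0$, $G(x,tv)=t^mG(x,v)$ for all $t>0$ with $m$ real, $m\ne1$, and $g_{ij}=\frac{\partial^2G}{\partial v^i\partial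 v^j}$ is nondegenerate. Let $\alpha=DG$ (and $d\alpha$ is symplectic), $g_h=g_{ij}\,dx^i\otimes dx^j$, and let $g_v$ be the bilinear form on $VTM'$ with $g_v(\partial/\partial v^i,\partial/\partial v^j)=g_{ij}$; Lorentzian means of signature $(n-1,1)$ or $(1,n-1)$. Let $V$ be the vector field with $V\lrcorner\,d\alpha=-(m-1)\,dG$ (usual interior product); in coordinates $V=v^i\frac{\partial}{\partial x^i}+u^i\frac{\partial}{\partial v^i}$ with $u^ig_{ij}=\frac{\partial G}{\partial x^j}-v^i\frac{\partial^2G}{\partial x^i\partial v^j}$; it is tangent to $\mathscr{H}$. Affinely parametrized null geodesics are the integral curves of $V$ on $\mathscr{H}$ (and their projections to $M$), the affine parameter being the parameter of the integral curve. Let $P=\frac12(\operatorname{Id}+\mathscr{L}_V\lambda):TTM'\to VTM'$, where $(\mathscr{L}_V\lambda)(Y)=[V,\lambda Y]-\lambda[V,Y]$. The tidal force tensor is the symmetric section $S$ of $V^0TM'\otimes V^0TM'$ determined by $\frac12(\mathscr{L}_V^2g_h)(Y,Z)=g_v(PY,PZ)+S(Y,Z)$ for all $Y,Z$. A continuous surjection $q:B\to A$ of Hausdorff spaces is a branched cover if the set of points of $B$ having an open neighborhood that $q$ maps homeomorphically onto an open subset of $A$ is dense in $B$. An affine Sachs manifold is an $n$-dimensional smooth submanifold $\mathcal{T}\subset\mathscr{H}$ such that the projection $\mathcal{T}\to M$ is a branched cover, $V$ is everywhere tangent to $\mathcal{T}$, and $\alpha\wedge d\alpha$ restricts to zero on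 $\mathcal{T}$. A Sachs section over an open set $U\subset M$ is a (smooth) section $s:U\to\mathcal{T}$ of the projection $\mathcal{T}\to M$ over $U$, where $\mathcal{T}$ is an affine Sachs manifold. Its vector field $k$ on $U$ is defined by $s_*k=V$ along $s$ (so $k(x)=s(x)$), and its congruence is the foliation of $U$ by the integral curves of $k$, which are affinely parametrized null geodesics. Let $g_s=s^*g_h$, a pseudo-Riemannian metric on $U$. The divergence $\theta$ of the congruence is defined by $\mathscr{L}_k|\Omega|=\theta|\Omega|$ with $|\Omega|$ the volume density of $g_s$; equivalently $\theta=\operatorname{tr}P_s$ with $P_s(Y)=\overline\lambda^{-1}P(s_*Y)$. The endomorphism $S^\sharp$ of $TU$ is defined by $g_s(S^\sharp Y,Z)=S(s_*Y,s_*Z)$. *)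

theory Defs
  imports "HOL-Analysis.Analysis"
begin

section \<open>Smooth maps and submanifolds in Euclidean space\<close>

primrec Ck_on :: "nat \<Rightarrow> 'b::real_normed_vector set \<Rightarrow> ('b \<Rightarrow> 'c::real_normed_vector) \<Rightarrow> bool" where
  "Ck_on 0 S f \<longleftrightarrow> continuous_on S f"
| "Ck_on (Suc k) S f \<longleftrightarrow>
     (\<forall>x\<in>S. f differentiable (at x)) \<and> (\<forall>v. Ck_on k S (\<lambda>x. frechet_derivative f (at x) v))"

text \<open>Only used for open \<open>S\<close>.\<close>

definition smooth_on :: "'b::real_normed_vector set \<Rightarrow> ('b \<Rightarrow> 'c::real_normed_vector) \<Rightarrow> bool" where
  "smooth_on S f \<longleftrightarrow> (\<forall>k. Ck_on k S f)"

definition submanifold :: "nat \<Rightarrow> 'b::euclidean_space set \<Rightarrow> bool" where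
  "submanifold d S \<longleftrightarrow>
     (\<forall>p\<in>S. \<exists>W \<Phi> L. open W \<and> p \<in> W \<and> smooth_on W \<Phi> \<and> inj_on \<Phi> W \<and>
        open (\<Phi> ` W) \<and> smooth_on (\<Phi> ` W) (inv_into W \<Phi>) \<and>
        subspace (L :: 'b set) \<and> dim L = d \<and> \<Phi> ` (S \<inter> W) = \<Phi> ` W \<inter> L)"

definition tangent_space :: "'b::euclidean_space set \<Rightarrow> 'b \<Rightarrow> 'b set" where
  "tangent_space S p =
     {Y. \<exists>\<epsilon>>0. \<exists>\<gamma>. smooth_on {-\<epsilon><..<\<epsilon>} \<gamma> \<and> \<gamma> ` {-\<epsilon><..<\<epsilon>} \<subseteq> S \<and>
           \<gamma> 0 = p \<and> (\<gamma> has_vector_derivative Y) (at (0::real))}"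

section \<open>Manifolds and the slit tangent bundle\<close>

type_synonym ('a, 'n) chart = "'a set \<times> ('a \<Rightarrow> real ^ 'n)"

abbreviation cdom :: "('a, 'n) chart \<Rightarrow> 'a set" where "cdom c \<equiv> fst c"
abbreviation cmap :: "('a, 'n) chart \<Rightarrow> 'a \<Rightarrow> real ^ 'n" where "cmap c \<equiv> snd c"

definition cinv :: "('a, 'n) chart \<Rightarrow> real ^ 'n \<Rightarrow> 'a" where
  "cinv c = inv_into (cdom c) (cmap c)"

definition smooth_manifold :: "'a topology \<Rightarrow> ('a, 'n::finite) chart set \<Rightarrow> bool" where
  "smooth_manifold M A \<longleftrightarrow>
     Hausdorff_space M \<and> second_countable M \<and> \<Union> (cdom ` A) = topspace M \<and>
     (\<forall>c\<in>A. openin M (cdom c) \<and> open (cmap c ` cdom c) \<and>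
        homeomorphic_map (subtopology M (cdom c)) (top_of_set (cmap c ` cdom c)) (cmap c)) \<and>
     (\<forall>c\<in>A. \<forall>d\<in>A. smooth_on (cmap c ` (cdom c \<inter> cdom d)) (cmap d \<circ> cinv c))"

text \<open>A tangent vector is a base point together with the family of its components in all charts
  of the atlas around that point (and \<open>0\<close> for all other charts), related by the transformation law.
  The map \<open>tvec A c\<close> is the inverse of the chart \<open>(x\<^sup>i, v\<^sup>i)\<close> of the tangent bundle
  induced by \<open>c\<close>, which itself is \<open>tcoord c\<close>.\<close>

type_synonym ('a, 'n) tangent = "'a \<times> (('a, 'n) chart \<Rightarrow> real ^ 'n)"

definition tvec ::
  "('a, 'n::finite) chart set \<Rightarrow> ('a, 'n) chart \<Rightarrow> (real ^ 'n) \<times> (real ^ 'n) \<Rightarrow> ('a, 'n) tangent" where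
  "tvec A c = (\<lambda>(x, v). (cinv c x, \<lambda>d. if d \<in> A \<and> cinv c x \<in> cdom d
       then frechet_derivative (cmap d \<circ> cinv c) (at x) v else 0))"

definition tcoord :: "('a, 'n) chart \<Rightarrow> ('a, 'n) tangent \<Rightarrow> (real ^ 'n) \<times> (real ^ 'n)" where
  "tcoord c z = (cmap c (fst z), snd z c)"

definition slit_tangent :: "('a, 'n::finite) chart set \<Rightarrow> ('a, 'n) tangent set" where
  "slit_tangent A = {tvec A c (x, v) |c x v. c \<in> A \<and> x \<in> cmap c ` cdom c \<and> v \<noteq> 0}"

definition tscale :: "real \<Rightarrow> ('a, 'n::finite) tangent \<Rightarrow> ('a, 'n) tangent" where
  "tscale r z = (fst z, \<lambda>c. r *\<^sub>R snd z c)"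

definition local_set :: "('a, 'n::finite) chart set \<Rightarrow> ('a, 'n) tangent set \<Rightarrow> ('a, 'n) chart
    \<Rightarrow> ((real ^ 'n) \<times> (real ^ 'n)) set" where
  "local_set A W c = {p. fst p \<in> cmap c ` cdom c \<and> tvec A c p \<in> W}"

definition local_fun :: "('a, 'n::finite) chart set \<Rightarrow> (('a, 'n) tangent \<Rightarrow> real) \<Rightarrow> ('a, 'n) chart
    \<Rightarrow> (real ^ 'n) \<times> (real ^ 'n) \<Rightarrow> real" where
  "local_fun A G c = G \<circ> tvec A c"

definition slit_topology :: "('a, 'n::finite) chart set \<Rightarrow> ('a, 'n) tangent topology" where
  "slit_topology A = topology (\<lambda>W. W \<subseteq> slit_tangent A \<and> (\<forall>c\<in>A. open (local_set A W c)))"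

lemma openin_slit_topology:
  "openin (slit_topology A) W \<longleftrightarrow> W \<subseteq> slit_tangent A \<and> (\<forall>c\<in>A. open (local_set A W c))"
proof -
  have Int: "local_set A (W \<inter> W') c = local_set A W c \<inter> local_set A W' c" for W W' c
    by (auto simp: local_set_def)
  have Un: "local_set A (\<Union>K) c = (\<Union>W\<in>K. local_set A W c)" for K c
    by (auto simp: local_set_def)
  have "istopology (\<lambda>W. W \<subseteq> slit_tangent A \<and> (\<forall>c\<in>A. open (local_set A W c)))"
    unfolding istopology_def Int Un by (blast intro: open_Int open_UN)
  then show ?thesis
    by (simp add: slit_topology_def topology_inverse')
qed

section \<open>Tensor calculus in coordinates\<close>

text \<open>Tensors are evaluated on constant (coordinate) vector fields \<open>Y\<close>, \<open>Z\<close>, which is no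
  restriction since the operations below are tensorial in their vector arguments.\<close>

definition lie_bracket :: "('b::euclidean_space \<Rightarrow> 'b) \<Rightarrow> ('b \<Rightarrow> 'b) \<Rightarrow> 'b \<Rightarrow> 'b" where
  "lie_bracket V W p = frechet_derivative W (at p) (V p) - frechet_derivative V (at p) (W p)"

definition lie_endo :: "('b::euclidean_space \<Rightarrow> 'b) \<Rightarrow> ('b \<Rightarrow> 'b \<Rightarrow> 'b) \<Rightarrow> 'b \<Rightarrow> 'b \<Rightarrow> 'b" where
  "lie_endo V E p Y = lie_bracket V (\<lambda>q. E q Y) p - E p (lie_bracket V (\<lambda>_. Y) p)"

definition lie_bilinear :: "('b::euclidean_space \<Rightarrow> 'b) \<Rightarrow> ('b \<Rightarrow> 'b \<Rightarrow> 'b \<Rightarrow> real)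
    \<Rightarrow> 'b \<Rightarrow> 'b \<Rightarrow> 'b \<Rightarrow> real" where
  "lie_bilinear V h p Y Z = frechet_derivative (\<lambda>q. h q Y Z) (at p) (V p)
     - h p (lie_bracket V (\<lambda>_. Y) p) Z - h p Y (lie_bracket V (\<lambda>_. Z) p)"

definition ext_deriv :: "('b::euclidean_space \<Rightarrow> 'b \<Rightarrow> real) \<Rightarrow> 'b \<Rightarrow> 'b \<Rightarrow> 'b \<Rightarrow> real" where
  "ext_deriv \<omega> p Y Z =
     frechet_derivative (\<lambda>q. \<omega> q Z) (at p) Y - frechet_derivative (\<lambda>q. \<omega> q Y) (at p) Z"

definition wedge12 :: "('b \<Rightarrow> real) \<Rightarrow> ('b \<Rightarrow> 'b \<Rightarrow> real) \<Rightarrow> 'b \<Rightarrow> 'b \<Rightarrow> 'b \<Rightarrow> real" where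
  "wedge12 \<omega> \<eta> X Y Z = \<omega> X * \<eta> Y Z + \<omega> Y * \<eta> Z X + \<omega> Z * \<eta> X Y"

text \<open>Lie derivative along \<open>k\<close> of the density \<open>\<rho> |dx\<^sup>1 \<dots> dx\<^sup>n|\<close>, as a multiple of the
  coordinate density.\<close>

definition lie_density :: "(real ^ 'n \<Rightarrow> real ^ 'n) \<Rightarrow> (real ^ 'n \<Rightarrow> real) \<Rightarrow> real ^ 'n \<Rightarrow> real" where
  "lie_density k \<rho> x =
     frechet_derivative \<rho> (at x) (k x) + \<rho> x * trace (matrix (frechet_derivative k (at x)))"

definition has_signature :: "(real ^ 'n \<Rightarrow> real ^ 'n \<Rightarrow> real) \<Rightarrow> nat \<Rightarrow> nat \<Rightarrow> bool" where
  "has_signature B p q \<longleftrightarrow>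
     (\<exists>e :: 'n \<Rightarrow> real ^ 'n. inj e \<and> independent (range e) \<and>
        (\<forall>i j. i \<noteq> j \<longrightarrow> B (e i) (e j) = 0) \<and>
        (\<forall>i. B (e i) (e i) \<noteq> 0) \<and>
        card {i. 0 < B (e i) (e i)} = p \<and> card {i. B (e i) (e i) < 0} = q)"

definition lorentzian :: "(real ^ 'n \<Rightarrow> real ^ 'n \<Rightarrow> real) \<Rightarrow> bool" where
  "lorentzian B \<longleftrightarrow> has_signature B (CARD('n) - 1) 1 \<or> has_signature B 1 (CARD('n) - 1)"

section \<open>The geometry of a function on the slit tangent bundle\<close>

text \<open>Here \<open>F\<close> is the coordinate expression of \<open>G\<close>, a function of \<open>p = (x, v)\<close>, and tangent vectors
  \<open>Y = (a, b)\<close> of the tangent bundle are \<open>a\<^sup>i \<partial>/\<partial>x\<^sup>i + b\<^sup>i \<partial>/\<partial>v\<^sup>i\<close>.\<close>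

context
  fixes F :: "(real ^ 'n) \<times> (real ^ 'n) \<Rightarrow> real"
begin

definition lam :: "(real ^ 'n) \<times> (real ^ 'n) \<Rightarrow> (real ^ 'n) \<times> (real ^ 'n)" where
  "lam Y = (0, fst Y)"

definition vpartial :: "'n \<Rightarrow> ((real ^ 'n) \<times> (real ^ 'n) \<Rightarrow> real) \<Rightarrow> (real ^ 'n) \<times> (real ^ 'n) \<Rightarrow> real" where
  "vpartial i f p = frechet_derivative f (at p) (0, axis i 1)"

definition alpha :: "(real ^ 'n) \<times> (real ^ 'n) \<Rightarrow> (real ^ 'n) \<times> (real ^ 'n) \<Rightarrow> real" where
  "alpha p Y = (\<Sum>i\<in>UNIV. vpartial i F p * fst Y $ i)"

definition gmat :: "(real ^ 'n) \<times> (real ^ 'n) \<Rightarrow> real ^ 'n ^ 'n" where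
  "gmat p = (\<chi> i j. vpartial i (vpartial j F) p)"

definition g_h :: "(real ^ 'n) \<times> (real ^ 'n) \<Rightarrow> (real ^ 'n) \<times> (real ^ 'n) \<Rightarrow> (real ^ 'n) \<times> (real ^ 'n) \<Rightarrow> real" where
  "g_h p Y Z = (\<Sum>i\<in>UNIV. \<Sum>j\<in>UNIV. gmat p $ i $ j * fst Y $ i * fst Z $ j)"

text \<open>Only applied to vertical vectors.\<close>

definition g_v :: "(real ^ 'n) \<times> (real ^ 'n) \<Rightarrow> (real ^ 'n) \<times> (real ^ 'n) \<Rightarrow> (real ^ 'n) \<times> (real ^ 'n) \<Rightarrow> real" where
  "g_v p Y Z = (\<Sum>i\<in>UNIV. \<Sum>j\<in>UNIV. gmat p $ i $ j * snd Y $ i * snd Z $ j)"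

definition spray :: "real \<Rightarrow> (real ^ 'n) \<times> (real ^ 'n) \<Rightarrow> (real ^ 'n) \<times> (real ^ 'n)" where
  "spray m p = (THE W. \<forall>Y. ext_deriv alpha p W Y = - (m - 1) * frechet_derivative F (at p) Y)"

definition P_tensor :: "real \<Rightarrow> (real ^ 'n) \<times> (real ^ 'n) \<Rightarrow> (real ^ 'n) \<times> (real ^ 'n)
    \<Rightarrow> (real ^ 'n) \<times> (real ^ 'n)" where
  "P_tensor m p Y = (1/2) *\<^sub>R (Y + lie_endo (spray m) (\<lambda>_. lam) p Y)"

definition tidal :: "real \<Rightarrow> (real ^ 'n) \<times> (real ^ 'n) \<Rightarrow> (real ^ 'n) \<times> (real ^ 'n)
    \<Rightarrow> (real ^ 'n) \<times> (real ^ 'n) \<Rightarrow> real" where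
  "tidal m p Y Z = (1/2) * lie_bilinear (spray m) (lie_bilinear (spray m) g_h) p Y Z
     - g_v p (P_tensor m p Y) (P_tensor m p Z)"

end

definition cone_structure :: "'a topology \<Rightarrow> ('a, 'n::finite) chart set \<Rightarrow> ('a, 'n) tangent set
    \<Rightarrow> ('a, 'n) tangent set \<Rightarrow> (('a, 'n) tangent \<Rightarrow> real) \<Rightarrow> real \<Rightarrow> bool" where
  "cone_structure M A H N G m \<longleftrightarrow>
     H \<subseteq> slit_tangent A \<and>
     (\<forall>z\<in>H. \<forall>r>0. tscale r z \<in> H) \<and>
     fst ` H = topspace M \<and>
     (\<forall>c\<in>A. submanifold (2 * CARD('n) - 1) (local_set A H c)) \<and>
     (\<forall>c\<in>A. \<forall>x\<in>cmap c ` cdom c. submanifold (CARD('n) - 1) {v. (x, v) \<in> local_set A H c}) \<and>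
     openin (slit_topology A) N \<and>
     (\<forall>z\<in>N. \<forall>r>0. tscale r z \<in> N) \<and>
     H = {z\<in>N. G z = 0} \<and>
     m \<noteq> 1 \<and>
     (\<forall>z\<in>N. \<forall>r>0. G (tscale r z) = r powr m * G z) \<and>
     (\<forall>c\<in>A. smooth_on (local_set A N c) (local_fun A G c)) \<and>
     (\<forall>c\<in>A. \<forall>p\<in>local_set A N c. \<exists>Y. alpha (local_fun A G c) p Y \<noteq> 0) \<and>
     (\<forall>c\<in>A. \<forall>p\<in>local_set A N c. det (gmat (local_fun A G c) p) \<noteq> 0)"

definition lorentzian_fibres :: "('a, 'n::finite) chart set \<Rightarrow> ('a, 'n) tangent set
    \<Rightarrow> (('a, 'n) tangent \<Rightarrow> real) \<Rightarrow> bool" where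
  "lorentzian_fibres A N G \<longleftrightarrow>
     (\<forall>c\<in>A. \<forall>p\<in>local_set A N c. lorentzian (\<lambda>a b. g_v (local_fun A G c) p (0, a) (0, b)))"

definition null_geodesic :: "('a, 'n::finite) chart set \<Rightarrow> ('a, 'n) tangent set
    \<Rightarrow> (('a, 'n) tangent \<Rightarrow> real) \<Rightarrow> real \<Rightarrow> real set \<Rightarrow> (real \<Rightarrow> 'a) \<Rightarrow> bool" where
  "null_geodesic A H G m I X \<longleftrightarrow>
     (\<exists>\<Gamma>. continuous_map (top_of_set I) (slit_topology A) \<Gamma> \<and> \<Gamma> ` I \<subseteq> H \<and>
        (\<forall>t\<in>I. fst (\<Gamma> t) = X t) \<and>
        (\<forall>t\<in>I. \<forall>c\<in>A. X t \<in> cdom c \<longrightarrow>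
           ((\<lambda>\<tau>. tcoord c (\<Gamma> \<tau>)) has_vector_derivative
              spray (local_fun A G c) m (tcoord c (\<Gamma> t))) (at t)))"

section \<open>Sachs manifolds and Sachs sections\<close>

definition branched_cover :: "'b topology \<Rightarrow> 'a topology \<Rightarrow> ('b \<Rightarrow> 'a) \<Rightarrow> bool" where
  "branched_cover B A q \<longleftrightarrow>
     Hausdorff_space B \<and> Hausdorff_space A \<and> continuous_map B A q \<and> q ` topspace B = topspace A \<and>
     B closure_of {b. \<exists>W. openin B W \<and> b \<in> W \<and> openin A (q ` W) \<and>
        homeomorphic_map (subtopology B W) (subtopology A (q ` W)) q} = topspace B"

definition affine_sachs_manifold :: "'a topology \<Rightarrow> ('a, 'n::finite) chart set \<Rightarrow> ('a, 'n) tangent set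
    \<Rightarrow> (('a, 'n) tangent \<Rightarrow> real) \<Rightarrow> real \<Rightarrow> ('a, 'n) tangent set \<Rightarrow> bool" where
  "affine_sachs_manifold M A H G m T \<longleftrightarrow>
     T \<subseteq> H \<and>
     (\<forall>c\<in>A. submanifold CARD('n) (local_set A T c)) \<and>
     branched_cover (subtopology (slit_topology A) T) M fst \<and>
     (\<forall>c\<in>A. \<forall>p\<in>local_set A T c.
        spray (local_fun A G c) m p \<in> tangent_space (local_set A T c) p) \<and>
     (\<forall>c\<in>A. \<forall>p\<in>local_set A T c. \<forall>X\<in>tangent_space (local_set A T c) p.
        \<forall>Y\<in>tangent_space (local_set A T c) p. \<forall>Z\<in>tangent_space (local_set A T c) p.
        wedge12 (alpha (local_fun A G c) p) (ext_deriv (alpha (local_fun A G c)) p) X Y Z = 0)"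

definition components :: "('a, 'n) chart \<Rightarrow> ('a \<Rightarrow> ('a, 'n) tangent) \<Rightarrow> real ^ 'n \<Rightarrow> real ^ 'n" where
  "components c s x = snd (s (cinv c x)) c"

definition sachs_section :: "'a topology \<Rightarrow> ('a, 'n::finite) chart set \<Rightarrow> ('a, 'n) tangent set
    \<Rightarrow> (('a, 'n) tangent \<Rightarrow> real) \<Rightarrow> real \<Rightarrow> 'a set \<Rightarrow> ('a \<Rightarrow> ('a, 'n) tangent) \<Rightarrow> bool" where
  "sachs_section M A H G m U s \<longleftrightarrow>
     openin M U \<and>
     (\<exists>T. affine_sachs_manifold M A H G m T \<and> s ` U \<subseteq> T) \<and>
     (\<forall>x\<in>U. fst (s x) = x) \<and>
     (\<forall>c\<in>A. smooth_on (cmap c ` (U \<inter> cdom c)) (components c s))"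

text \<open>In the following, \<open>F\<close> and \<open>\<sigma>\<close> are the coordinate expressions of \<open>G\<close> and of the section.\<close>

definition pushforward :: "(real ^ 'n \<Rightarrow> real ^ 'n) \<Rightarrow> real ^ 'n \<Rightarrow> real ^ 'n
    \<Rightarrow> (real ^ 'n) \<times> (real ^ 'n)" where
  "pushforward \<sigma> x Y = (Y, frechet_derivative \<sigma> (at x) Y)"

definition congruence_field :: "((real ^ 'n) \<times> (real ^ 'n) \<Rightarrow> real) \<Rightarrow> real
    \<Rightarrow> (real ^ 'n \<Rightarrow> real ^ 'n) \<Rightarrow> real ^ 'n \<Rightarrow> real ^ 'n" where
  "congruence_field F m \<sigma> x = (THE k. pushforward \<sigma> x k = spray F m (x, \<sigma> x))"

definition g_s :: "((real ^ 'n) \<times> (real ^ 'n) \<Rightarrow> real) \<Rightarrow> (real ^ 'n \<Rightarrow> real ^ 'n)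
    \<Rightarrow> real ^ 'n \<Rightarrow> real ^ 'n \<Rightarrow> real ^ 'n \<Rightarrow> real" where
  "g_s F \<sigma> x Y Z = g_h F (x, \<sigma> x) (pushforward \<sigma> x Y) (pushforward \<sigma> x Z)"

definition volume_density :: "((real ^ 'n) \<times> (real ^ 'n) \<Rightarrow> real) \<Rightarrow> (real ^ 'n \<Rightarrow> real ^ 'n)
    \<Rightarrow> real ^ 'n \<Rightarrow> real" where
  "volume_density F \<sigma> x =
     sqrt \<bar>det ((\<chi> i j. g_s F \<sigma> x (axis i 1) (axis j 1)) :: real ^ 'n ^ 'n)\<bar>"

definition S_sharp :: "((real ^ 'n) \<times> (real ^ 'n) \<Rightarrow> real) \<Rightarrow> real \<Rightarrow> (real ^ 'n \<Rightarrow> real ^ 'n)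
    \<Rightarrow> real ^ 'n \<Rightarrow> real ^ 'n \<Rightarrow> real ^ 'n" where
  "S_sharp F m \<sigma> x Y =
     (THE W. \<forall>Z. g_s F \<sigma> x W Z = tidal F m (x, \<sigma> x) (pushforward \<sigma> x Y) (pushforward \<sigma> x Z))"

definition congruence_member :: "'a topology \<Rightarrow> ('a, 'n::finite) chart set
    \<Rightarrow> (('a, 'n) tangent \<Rightarrow> real) \<Rightarrow> real \<Rightarrow> ('a \<Rightarrow> ('a, 'n) tangent) \<Rightarrow> real set \<Rightarrow> (real \<Rightarrow> 'a) \<Rightarrow> bool" where
  "congruence_member M A G m s I X \<longleftrightarrow>
     continuous_map (top_of_set I) M X \<and>
     (\<forall>t\<in>I. \<forall>c\<in>A. X t \<in> cdom c \<longrightarrow>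
        ((\<lambda>\<tau>. cmap c (X \<tau>)) has_vector_derivative
           congruence_field (local_fun A G c) m (components c s) (cmap c (X t))) (at t))"

definition positive_energy_at :: "('a, 'n::finite) chart set \<Rightarrow> (('a, 'n) tangent \<Rightarrow> real) \<Rightarrow> real
    \<Rightarrow> ('a \<Rightarrow> ('a, 'n) tangent) \<Rightarrow> 'a \<Rightarrow> bool" where
  "positive_energy_at A G m s y \<longleftrightarrow>
     (\<forall>c\<in>A. y \<in> cdom c \<longrightarrow>
        trace (matrix (S_sharp (local_fun A G c) m (components c s) (cmap c y))) \<le> 0)"

text \<open>The defining equation of the divergence: the Lie derivative of the volume density is
  \<open>\<theta>\<close> times the volume density. Both sides being densities, the function \<open>\<theta>\<close> does not depend on
  the chart; it is determined on \<open>U\<close> since the volume density does not vanish.\<close>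

definition divergence_on :: "('a, 'n::finite) chart set \<Rightarrow> (('a, 'n) tangent \<Rightarrow> real) \<Rightarrow> real
    \<Rightarrow> 'a set \<Rightarrow> ('a \<Rightarrow> ('a, 'n) tangent) \<Rightarrow> ('a \<Rightarrow> real) \<Rightarrow> bool" where
  "divergence_on A G m U s \<theta> \<longleftrightarrow>
     (\<forall>c\<in>A. \<forall>y\<in>U \<inter> cdom c.
        lie_density (congruence_field (local_fun A G c) m (components c s))
          (volume_density (local_fun A G c) (components c s)) (cmap c y) =
        \<theta> y * volume_density (local_fun A G c) (components c s) (cmap c y))"

end

theory Submission
  imports Defs
begin

text \<open>
  In a chart the Sachs section is a vector field \<open>\<sigma>\<close> with \<open>k = \<sigma>\<close>, and, writing
  \<open>V = v\<^sup>i \<partial>/\<partial>x\<^sup>i + u\<^sup>i \<partial>/\<partial>v\<^sup>i\<close>, the endomorphism \<open>P\<^sub>s\<close> is \<open>d\<sigma> - \<partial>u/\<partial>v / 2\<close>. The fibre derivative of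
  the Euler--Lagrange equation determines \<open>V g\<^sub>i\<^sub>j\<close> from \<open>\<partial>u/\<partial>v\<close>, which gives \<open>\<theta> = tr P\<^sub>s\<close> and,
  after a second Lie derivative, the Raychaudhuri equation \<open>\<theta>' = tr S\<^sup>\<sharp> - tr (P\<^sub>s\<^sup>2)\<close>.
  Homogeneity gives \<open>P\<^sub>s k = 0\<close> and \<open>P\<^sub>s TU \<subseteq> k\<^sup>\<bottom>\<close>, and vanishing of \<open>\<alpha> \<and> d\<alpha>\<close> makes \<open>P\<^sub>s\<close> self-adjoint
  on the definite quotient \<open>k\<^sup>\<bottom> / k\<close> of dimension \<open>n - 2\<close>. So Cauchy--Schwarz yields
  \<open>\<theta>' \<le> - \<theta>\<^sup>2 / (n - 2)\<close>, and a negative value of \<open>\<theta>\<close> would force blow-up in finite time.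
\<close>

section \<open>Calculus of smooth functions\<close>

text \<open>Euler's identity gives g(v, .) = (m - 1) \<alpha>. As m \<noteq> 1, the kernel of
  \<alpha> on the section is the orthogonal complement of k, and there \<alpha> \<and> d\<alpha> = 0
  forces d\<alpha> = 0; the pulled back d\<alpha> is exactly the failure of \<open>P_s\<close> to be
  self-adjoint. Passing to the quotient loses no trace: \<open>P_s\<close> acts as zero on the line
  of k and modulo the complement of k, so the traces of \<open>P_s\<close> and of its square are
  those of the induced map, which is compared by Cauchy-Schwarz with an identity of trace n - 2.
  Self-adjointness ignores the overall sign of the metric, so both Lorentzian conventions are
  treated alike. The obstacle is the tidal tensor: it involves position derivatives of u, which
  \<open>P_s\<close> does not see. Differentiating the geodesic equation d\<sigma>(\<sigma>) = u
  along the section trades them for second derivatives of \<sigma>. What remains is the symmetric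
  part of the square of \<open>P_s\<close> plus its Lie derivative along k; in coordinates the
  latter differs from a plain derivative by a commutator, which has no trace.\<close>

abbreviation dd :: "('b::real_normed_vector \<Rightarrow> 'c::real_normed_vector) \<Rightarrow> 'b \<Rightarrow> 'b \<Rightarrow> 'c"
  where "dd f p \<equiv> frechet_derivative f (at p)"

lemma dd_eqI: "(f has_derivative f') (at p) \<Longrightarrow> dd f p = f'"
  by (metis frechet_derivative_at)

lemma dd_works: "f differentiable (at p) \<Longrightarrow> (f has_derivative dd f p) (at p)"
  by (simp add: frechet_derivative_works)

lemma dd_cong:
  assumes "open S" "p \<in> S" "\<And>x. x \<in> S \<Longrightarrow> f x = g x" "f differentiable (at p)"
  shows "dd f p = dd g p"
  using frechet_derivative_transform_within_open assms by blast

lemma differentiable_cong: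
  assumes "open S" "p \<in> S" "\<And>x. x \<in> S \<Longrightarrow> f x = g x" "f differentiable (at p)"
  shows "g differentiable (at p)"
  using assms has_derivative_transform_within_open unfolding differentiable_def by metis

section \<open>Locality of smoothness and its stability under algebraic operations\<close>

lemma Ck_on_cong:
  assumes "open S" "\<And>x. x \<in> S \<Longrightarrow> f x = g x" "Ck_on k S f"
  shows "Ck_on k S g"
  using assms(2,3)
proof (induction k arbitrary: f g)
  case 0
  then show ?case by (simp cong: continuous_on_cong)
next
  case (Suc k)
  have d: "f differentiable (at x)" if "x \<in> S" for x
    using Suc.prems(2) that by simp
  have *: "dd f x = dd g x" "g differentiable (at x)" if "x \<in> S" for x
    using dd_cong[OF assms(1) that _ d[OF that], of g] differentiable_cong[OF assms(1) that _ d[OF that], of g]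
      Suc.prems(1) by blast+
  show ?case
    using Suc.IH[of "\<lambda>x. dd f x _" "\<lambda>x. dd g x _"] Suc.prems(2) * by auto
qed

lemma Ck_on_SucD: "Ck_on (Suc k) S f \<Longrightarrow> Ck_on k S f"
proof (induction k arbitrary: f)
  case 0
  then show ?case
    using continuous_at_imp_continuous_on differentiable_imp_continuous_within by fastforce
next
  case (Suc k)
  then show ?case by auto
qed

lemma smooth_on_differentiable: "smooth_on S f \<Longrightarrow> x \<in> S \<Longrightarrow> f differentiable (at x)"
  unfolding smooth_on_def by (metis Ck_on.simps(2))

lemma smooth_on_has_derivative: "smooth_on S f \<Longrightarrow> x \<in> S \<Longrightarrow> (f has_derivative dd f x) (at x)"
  using smooth_on_differentiable dd_works by blast

lemma smooth_on_dd: "smooth_on S f \<Longrightarrow> smooth_on S (\<lambda>x. dd f x v)"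
  unfolding smooth_on_def by (metis Ck_on.simps(2))

lemma smooth_on_continuous: "smooth_on S f \<Longrightarrow> continuous_on S f"
  unfolding smooth_on_def by (metis Ck_on.simps(1))

lemma linear_dd: "smooth_on S f \<Longrightarrow> x \<in> S \<Longrightarrow> linear (dd f x)"
  using smooth_on_differentiable linear_frechet_derivative by blast

lemma Ck_on_const: "Ck_on k S (\<lambda>x. c)"
  by (induction k arbitrary: c) auto

lemma Ck_on_bounded_linear:
  assumes "open S" "bounded_linear L" "Ck_on k S f"
  shows "Ck_on k S (\<lambda>x. L (f x))"
  using assms(3)
proof (induction k arbitrary: f)
  case 0
  then show ?case
    using assms(2) by (auto intro: bounded_linear.continuous_on)
next
  case (Suc k)
  have *: "((\<lambda>x. L (f x)) has_derivative (\<lambda>v. L (dd f x v))) (at x)" if "x \<in> S" for x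
    using Suc.prems that by (intro bounded_linear.has_derivative[OF assms(2)] dd_works) auto
  have "Ck_on k S (\<lambda>x. dd (\<lambda>x. L (f x)) x v)" for v
    by (rule Ck_on_cong[OF assms(1) _ Suc.IH[of "\<lambda>x. dd f x v"]])
      (use dd_eqI[OF *] Suc.prems in auto)
  then show ?case
    using * by (auto simp: differentiable_def)
qed

lemma Ck_on_add:
  assumes "open S" "Ck_on k S f" "Ck_on k S g"
  shows "Ck_on k S (\<lambda>x. f x + g x)"
  using assms(2,3)
proof (induction k arbitrary: f g)
  case 0
  then show ?case by (auto intro: continuous_intros)
next
  case (Suc k)
  have *: "((\<lambda>x. f x + g x) has_derivative (\<lambda>v. dd f x v + dd g x v)) (at x)" if "x \<in> S" for x
    using Suc.prems that by (intro has_derivative_add dd_works) auto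
  have "Ck_on k S (\<lambda>x. dd (\<lambda>x. f x + g x) x v)" for v
    by (rule Ck_on_cong[OF assms(1) _ Suc.IH[of "\<lambda>x. dd f x v" "\<lambda>x. dd g x v"]])
      (use dd_eqI[OF *] Suc.prems in auto)
  then show ?case
    using * by (auto simp: differentiable_def)
qed

lemma Ck_on_mult:
  fixes f g :: "'b::real_normed_vector \<Rightarrow> real"
  assumes "open S" "Ck_on k S f" "Ck_on k S g"
  shows "Ck_on k S (\<lambda>x. f x * g x)"
  using assms(2,3)
proof (induction k arbitrary: f g)
  case 0
  then show ?case by (auto intro: continuous_intros)
next
  case (Suc k)
  have *: "((\<lambda>x. f x * g x) has_derivative (\<lambda>v. f x * dd g x v + dd f x v * g x)) (at x)"
    if "x \<in> S" for x
    using Suc.prems that by (intro has_derivative_mult dd_works) auto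
  have "Ck_on k S (\<lambda>x. dd (\<lambda>x. f x * g x) x v)" for v
  proof (rule Ck_on_cong[OF assms(1)])
    show "Ck_on k S (\<lambda>x. f x * dd g x v + dd f x v * g x)"
      using Suc.prems by (auto intro!: Ck_on_add[OF assms(1)] Suc.IH intro: Ck_on_SucD)
  qed (simp add: dd_eqI[OF *])
  then show ?case
    using * by (auto simp: differentiable_def)
qed

lemma Ck_on_inverse:
  fixes f :: "'b::real_normed_vector \<Rightarrow> real"
  assumes "open S" "Ck_on k S f" "\<And>x. x \<in> S \<Longrightarrow> f x \<noteq> 0"
  shows "Ck_on k S (\<lambda>x. inverse (f x))"
  using assms(2)
proof (induction k)
  case 0
  then show ?case using assms(3) by (auto intro!: continuous_intros)
next
  case (Suc k)
  have *: "((\<lambda>x. inverse (f x)) has_derivative (\<lambda>v. - (inverse (f x) * dd f x v * inverse (f x)))) (at x)"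
    if "x \<in> S" for x
    using Suc.prems that by (intro Deriv.has_derivative_inverse assms dd_works) auto
  have i: "Ck_on k S (\<lambda>x. inverse (f x))"
    using Suc Ck_on_SucD by blast
  have "Ck_on k S (\<lambda>x. dd (\<lambda>x. inverse (f x)) x v)" for v
  proof (rule Ck_on_cong[OF assms(1)])
    show "Ck_on k S (\<lambda>x. - (inverse (f x) * dd f x v * inverse (f x)))"
      using Suc.prems i
      by (auto intro!: Ck_on_mult[OF assms(1)] Ck_on_bounded_linear[OF assms(1) bounded_linear_minus[OF bounded_linear_ident]])
  qed (simp add: dd_eqI[OF *])
  then show ?case
    using * by (auto simp: differentiable_def)
qed

lemma smooth_on_const: "smooth_on S (\<lambda>x. c)"
  by (simp add: smooth_on_def Ck_on_const)

lemma smooth_on_bounded_linear: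
  "open S \<Longrightarrow> bounded_linear L \<Longrightarrow> smooth_on S f \<Longrightarrow> smooth_on S (\<lambda>x. L (f x))"
  by (simp add: smooth_on_def Ck_on_bounded_linear)

lemma smooth_on_ident: "smooth_on S (\<lambda>x. x)"
  unfolding smooth_on_def
proof
  show "Ck_on k S (\<lambda>x. x)" for k
    by (cases k) (auto simp: Ck_on_const)
qed

lemma smooth_on_add: "open S \<Longrightarrow> smooth_on S f \<Longrightarrow> smooth_on S g \<Longrightarrow> smooth_on S (\<lambda>x. f x + g x)"
  by (simp add: smooth_on_def Ck_on_add)

lemma smooth_on_minus: "open S \<Longrightarrow> smooth_on S f \<Longrightarrow> smooth_on S (\<lambda>x. - f x)"
  by (rule smooth_on_bounded_linear[OF _ bounded_linear_minus[OF bounded_linear_ident]])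

lemma smooth_on_mult:
  fixes f g :: "'b::real_normed_vector \<Rightarrow> real"
  shows "open S \<Longrightarrow> smooth_on S f \<Longrightarrow> smooth_on S g \<Longrightarrow> smooth_on S (\<lambda>x. f x * g x)"
  by (simp add: smooth_on_def Ck_on_mult)

lemma smooth_on_divide:
  fixes f g :: "'b::real_normed_vector \<Rightarrow> real"
  shows "open S \<Longrightarrow> smooth_on S f \<Longrightarrow> smooth_on S g \<Longrightarrow> (\<And>x. x \<in> S \<Longrightarrow> g x \<noteq> 0)
    \<Longrightarrow> smooth_on S (\<lambda>x. f x / g x)"
  unfolding divide_inverse by (simp add: smooth_on_def Ck_on_mult Ck_on_inverse)

lemma smooth_on_sum:
  "open S \<Longrightarrow> (\<And>i. i \<in> J \<Longrightarrow> smooth_on S (f i)) \<Longrightarrow> smooth_on S (\<lambda>x. \<Sum>i\<in>J. f i x)"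
  by (induction J rule: infinite_finite_induct) (auto intro: smooth_on_const smooth_on_add)

lemma smooth_on_prod:
  fixes f :: "'i \<Rightarrow> 'b::real_normed_vector \<Rightarrow> real"
  shows "open S \<Longrightarrow> (\<And>i. i \<in> J \<Longrightarrow> smooth_on S (f i)) \<Longrightarrow> smooth_on S (\<lambda>x. \<Prod>i\<in>J. f i x)"
  by (induction J rule: infinite_finite_induct) (auto intro: smooth_on_const smooth_on_mult)

lemma smooth_on_vec_lambda:
  fixes f :: "'i::finite \<Rightarrow> 'b::real_normed_vector \<Rightarrow> real"
  assumes "open S" "\<And>i. smooth_on S (f i)"
  shows "smooth_on S (\<lambda>x. \<chi> i. f i x)"
proof -
  have "(\<lambda>x. \<chi> i. f i x) = (\<lambda>x. \<Sum>i\<in>UNIV. f i x *\<^sub>R axis i 1)"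
    by (simp add: fun_eq_iff vec_eq_iff axis_def if_distrib cong: if_cong)
  then show ?thesis
    using assms by (auto intro!: smooth_on_sum smooth_on_bounded_linear[OF _ bounded_linear_scaleR_left])
qed

lemma smooth_on_det:
  fixes f :: "'b::real_normed_vector \<Rightarrow> real ^ 'i::finite ^ 'i"
  assumes "open S" "\<And>i j. smooth_on S (\<lambda>x. f x $ i $ j)"
  shows "smooth_on S (\<lambda>x. det (f x))"
  unfolding det_def using assms
  by (auto intro!: smooth_on_sum smooth_on_mult smooth_on_const smooth_on_prod)

section \<open>Symmetry of mixed second derivatives\<close>

text \<open>The second difference is an increment in direction b of increments in direction a, so
  the mean value theorem applies once in each direction. It is symmetric in a and b, which
  \<open>dd_swap_real\<close> exploits.\<close>

lemma second_difference_mean_value: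
  fixes f :: "'b::real_normed_vector \<Rightarrow> real"
  assumes f: "smooth_on D f" and "0 < s"
    and box: "\<And>\<xi> \<eta>. 0 \<le> \<xi> \<Longrightarrow> \<xi> \<le> s \<Longrightarrow> 0 \<le> \<eta> \<Longrightarrow> \<eta> \<le> s \<Longrightarrow> p + \<xi> *\<^sub>R a + \<eta> *\<^sub>R b \<in> D"
  obtains \<xi> \<eta> where "0 < \<xi>" "\<xi> < s" "0 < \<eta>" "\<eta> < s"
    "f (p + s *\<^sub>R a + s *\<^sub>R b) - f (p + s *\<^sub>R a) - f (p + s *\<^sub>R b) + f p
      = s * s * dd (\<lambda>q. dd f q a) (p + \<xi> *\<^sub>R a + \<eta> *\<^sub>R b) b"
proof -
  have line: "((\<lambda>t. h (c + t *\<^sub>R d)) has_real_derivative dd h (c + t *\<^sub>R d) d) (at t)"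
    if "smooth_on D h" "c + t *\<^sub>R d \<in> D" for h :: "'b \<Rightarrow> real" and c d t
  proof -
    have "((\<lambda>t. h (c + t *\<^sub>R d)) has_derivative (\<lambda>r. dd h (c + t *\<^sub>R d) (r *\<^sub>R d))) (at t)"
      using smooth_on_has_derivative[OF that]
      by (intro has_derivative_compose[where g=h and f="\<lambda>t. c + t *\<^sub>R d"])
        (auto intro!: derivative_eq_intros)
    then show ?thesis
      by (simp add: has_field_derivative_def linear_cmul[OF linear_dd[OF that]] mult_commute_abs)
  qed
  define \<phi> where "\<phi> t = f (p + s *\<^sub>R b + t *\<^sub>R a) - f (p + t *\<^sub>R a)" for t
  have "(\<phi> has_real_derivative dd f (p + s *\<^sub>R b + t *\<^sub>R a) a - dd f (p + t *\<^sub>R a) a) (at t)"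
    if "0 \<le> t" "t \<le> s" for t
    unfolding \<phi>_def using box[of t s] box[of t 0] that \<open>0 < s\<close>
    by (intro DERIV_diff line[OF f]) (auto simp: algebra_simps)
  then obtain \<xi> where \<xi>: "0 < \<xi>" "\<xi> < s"
    "\<phi> s - \<phi> 0 = (s - 0) * (dd f (p + s *\<^sub>R b + \<xi> *\<^sub>R a) a - dd f (p + \<xi> *\<^sub>R a) a)"
    using MVT2[OF \<open>0 < s\<close>, of \<phi> "\<lambda>t. dd f (p + s *\<^sub>R b + t *\<^sub>R a) a - dd f (p + t *\<^sub>R a) a"] by auto
  define \<psi> where "\<psi> t = dd f (p + \<xi> *\<^sub>R a + t *\<^sub>R b) a" for t
  have "(\<psi> has_real_derivative dd (\<lambda>q. dd f q a) (p + \<xi> *\<^sub>R a + t *\<^sub>R b) b) (at t)"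
    if "0 \<le> t" "t \<le> s" for t
    unfolding \<psi>_def by (rule line) (use box[of \<xi> t] \<xi> that in \<open>auto intro: smooth_on_dd f\<close>)
  then obtain \<eta> where \<eta>: "0 < \<eta>" "\<eta> < s"
    "\<psi> s - \<psi> 0 = (s - 0) * dd (\<lambda>q. dd f q a) (p + \<xi> *\<^sub>R a + \<eta> *\<^sub>R b) b"
    using MVT2[OF \<open>0 < s\<close>, of \<psi> "\<lambda>t. dd (\<lambda>q. dd f q a) (p + \<xi> *\<^sub>R a + t *\<^sub>R b) b"] by auto
  show thesis
    by (rule that[OF \<xi>(1,2) \<eta>(1,2)])
      (use \<xi>(3) \<eta>(3) in \<open>simp add: \<phi>_def \<psi>_def algebra_simps\<close>)
qed

text \<open>Both mixed derivatives, taken at suitable nearby points, equal the same second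
  difference divided by s * s; continuity lets the parallelogram shrink to p.\<close>

theorem dd_swap_real:
  fixes f :: "'b::real_normed_vector \<Rightarrow> real"
  assumes f: "smooth_on D f" and D: "open D" "p \<in> D"
  shows "dd (\<lambda>q. dd f q a) p b = dd (\<lambda>q. dd f q b) p a"
proof -
  define h where "h = (\<lambda>a b q. dd (\<lambda>q. dd f q a) q b)"
  have cont: "continuous (at p) (h a b)" for a b
    using smooth_on_continuous[OF smooth_on_dd[OF smooth_on_dd[OF f]]] D
    unfolding h_def by (metis continuous_on_eq_continuous_at)
  have "\<bar>h a b p - h b a p\<bar> \<le> e" if "e > 0" for e
  proof -
    have "\<exists>d>0. \<forall>q. dist q p < d \<longrightarrow> \<bar>h a b q - h a b p\<bar> < e/2" for a b
      using cont[of a b, unfolded continuous_at_eps_delta, rule_format, of "e/2"] \<open>e > 0\<close>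
      by (auto simp: dist_real_def)
    then obtain d1 d2 where d: "d1 > 0" "d2 > 0"
      "\<And>q. dist q p < d1 \<Longrightarrow> \<bar>h a b q - h a b p\<bar> < e/2"
      "\<And>q. dist q p < d2 \<Longrightarrow> \<bar>h b a q - h b a p\<bar> < e/2"
      by metis
    obtain d3 where d3: "d3 > 0" "\<And>q. dist q p < d3 \<Longrightarrow> q \<in> D"
      using D open_dist by metis
    \<comment> \<open>The parallelogram with sides s a and s b has to fit into a ball inside D on
      which both continuity estimates hold. The summand 1 keeps the denominator of \<open>s\<close>
      positive when a = b = 0.\<close>
    define d0 where "d0 = min d1 (min d2 d3)"
    define s where "s = d0 / 2 / (norm a + norm b + 1)"
    have n: "norm a + norm b + 1 > 0" by (smt (verit) norm_ge_zero)
    have d0: "d0 > 0" using d d3 by (simp add: d0_def)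
    then have s: "s > 0" using n by (simp add: s_def)
    have "s * (norm a + norm b + 1) = d0 / 2" unfolding s_def using n
      by (metis nonzero_eq_divide_eq less_irrefl)
    then have s': "s * (norm a + norm b) < d0" using s d0 by (simp add: algebra_simps)
    have near: "dist (p + \<xi> *\<^sub>R a + \<eta> *\<^sub>R b) p < d0" if "0 \<le> \<xi>" "\<xi> \<le> s" "0 \<le> \<eta>" "\<eta> \<le> s" for \<xi> \<eta>
    proof -
      have "dist (p + \<xi> *\<^sub>R a + \<eta> *\<^sub>R b) p \<le> \<xi> * norm a + \<eta> * norm b"
        using norm_triangle_ineq[of "\<xi> *\<^sub>R a" "\<eta> *\<^sub>R b"] that by (simp add: dist_norm algebra_simps)
      also have "\<dots> \<le> s * norm a + s * norm b"
        using that by (intro add_mono mult_right_mono) auto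
      finally show ?thesis using s' by (simp add: algebra_simps)
    qed
    have box: "p + \<xi> *\<^sub>R a + \<eta> *\<^sub>R b \<in> D" if "0 \<le> \<xi>" "\<xi> \<le> s" "0 \<le> \<eta>" "\<eta> \<le> s" for \<xi> \<eta>
      using near[OF that] d3 by (simp add: d0_def)
    obtain \<xi> \<eta> where 1: "0 < \<xi>" "\<xi> < s" "0 < \<eta>" "\<eta> < s"
      "f (p + s *\<^sub>R a + s *\<^sub>R b) - f (p + s *\<^sub>R a) - f (p + s *\<^sub>R b) + f p
        = s * s * h a b (p + \<xi> *\<^sub>R a + \<eta> *\<^sub>R b)"
      using second_difference_mean_value[OF f s box] unfolding h_def by blast
    have box': "p + \<xi> *\<^sub>R b + \<eta> *\<^sub>R a \<in> D" if "0 \<le> \<xi>" "\<xi> \<le> s" "0 \<le> \<eta>" "\<eta> \<le> s" for \<xi> \<eta>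
      using box[of \<eta> \<xi>] that by (simp add: algebra_simps)
    obtain \<xi>' \<eta>' where 2: "0 < \<xi>'" "\<xi>' < s" "0 < \<eta>'" "\<eta>' < s"
      "f (p + s *\<^sub>R b + s *\<^sub>R a) - f (p + s *\<^sub>R b) - f (p + s *\<^sub>R a) + f p
        = s * s * h b a (p + \<xi>' *\<^sub>R b + \<eta>' *\<^sub>R a)"
      using second_difference_mean_value[OF f s box'] unfolding h_def by blast
    have "s * s * h a b (p + \<xi> *\<^sub>R a + \<eta> *\<^sub>R b) = s * s * h b a (p + \<xi>' *\<^sub>R b + \<eta>' *\<^sub>R a)"
      using 1(5) 2(5) by (simp add: algebra_simps)
    then have "h a b (p + \<xi> *\<^sub>R a + \<eta> *\<^sub>R b) = h b a (p + \<xi>' *\<^sub>R b + \<eta>' *\<^sub>R a)"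
      using s by simp
    moreover have "dist (p + \<xi> *\<^sub>R a + \<eta> *\<^sub>R b) p < d1" using near[of \<xi> \<eta>] 1 by (simp add: d0_def)
    moreover have "dist (p + \<xi>' *\<^sub>R b + \<eta>' *\<^sub>R a) p < d2"
      using near[of \<eta>' \<xi>'] 2 by (simp add: d0_def algebra_simps)
    moreover have "\<bar>x - y\<bar> \<le> e" if "\<bar>z - x\<bar> < e / 2" "\<bar>z - y\<bar> < e / 2" for x y z :: real
      using that by linarith
    ultimately show ?thesis
      using d(3)[of "p + \<xi> *\<^sub>R a + \<eta> *\<^sub>R b"] d(4)[of "p + \<xi>' *\<^sub>R b + \<eta>' *\<^sub>R a"]
      by presburger
  qed
  then have "\<bar>h a b p - h b a p\<bar> \<le> 0" by (rule field_le_epsilon) simp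
  then show ?thesis by (simp add: h_def)
qed

theorem dd_swap:
  fixes f :: "'b::real_normed_vector \<Rightarrow> 'c::euclidean_space"
  assumes f: "smooth_on D f" and D: "open D" "p \<in> D"
  shows "dd (\<lambda>q. dd f q a) p b = dd (\<lambda>q. dd f q b) p a"
proof (rule euclidean_eqI)
  fix e :: 'c
  have sm: "smooth_on D (\<lambda>q. h q \<bullet> e)" if "smooth_on D h" for h :: "'b \<Rightarrow> 'c"
    using smooth_on_bounded_linear[OF D(1) bounded_linear_inner_left that] .
  have *: "dd (\<lambda>q. h q \<bullet> e) q v = dd h q v \<bullet> e" if "smooth_on D h" "q \<in> D" for h :: "'b \<Rightarrow> 'c" and q v
    using dd_eqI[OF has_derivative_inner_left[OF smooth_on_has_derivative[OF that]]] by simp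
  have "dd (\<lambda>q. dd f q a) p b \<bullet> e = dd (\<lambda>q. dd (\<lambda>q. f q \<bullet> e) q a) p b" for a b
  proof -
    have "dd (\<lambda>q. dd f q a) p b \<bullet> e = dd (\<lambda>q. dd f q a \<bullet> e) p b"
      using *[OF smooth_on_dd[OF f] D(2)] by simp
    also have "\<dots> = dd (\<lambda>q. dd (\<lambda>q. f q \<bullet> e) q a) p b"
      using dd_cong[OF D, of "\<lambda>q. dd f q a \<bullet> e" "\<lambda>q. dd (\<lambda>q. f q \<bullet> e) q a"] *[OF f]
        smooth_on_differentiable[OF sm[OF smooth_on_dd[OF f]] D(2)] by simp
    finally show ?thesis .
  qed
  then show "dd (\<lambda>q. dd f q a) p b \<bullet> e = dd (\<lambda>q. dd f q b) p a \<bullet> e"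
    using dd_swap_real[OF sm[OF f] D] by simp
qed

text \<open>Base point and argument of the derivative both move with q, whereas smoothness controls
  derivatives for a fixed argument. Expanding the argument in a basis reduces this to the product
  rule.\<close>

lemma has_derivative_dd_apply:
  fixes f :: "'b::euclidean_space \<Rightarrow> 'c::euclidean_space" and W :: "'d::real_normed_vector \<Rightarrow> 'b"
  assumes f: "smooth_on D f" and "open D" and D: "\<pi> p \<in> D"
    and \<pi>: "(\<pi> has_derivative \<pi>') (at p)" and W: "(W has_derivative W') (at p)"
    and nbhd: "open E" "p \<in> E" "\<pi> ` E \<subseteq> D"
  shows "((\<lambda>q. dd f (\<pi> q) (W q)) has_derivative
    (\<lambda>Y. dd (\<lambda>q. dd f q (W p)) (\<pi> p) (\<pi>' Y) + dd f (\<pi> p) (W' Y))) (at p)"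
proof -
  have expand: "dd f q w = (\<Sum>b\<in>Basis. (w \<bullet> b) *\<^sub>R dd f q b)" if "q \<in> D" for q w
  proof -
    have "dd f q w = dd f q (\<Sum>b\<in>Basis. (w \<bullet> b) *\<^sub>R b)" by (simp add: euclidean_representation)
    also have "\<dots> = (\<Sum>b\<in>Basis. (w \<bullet> b) *\<^sub>R dd f q b)"
      using linear_dd[OF f that] by (simp add: linear_sum linear_cmul)
    finally show ?thesis .
  qed
  have comp: "((\<lambda>q. dd f (\<pi> q) b) has_derivative (\<lambda>Y. dd (\<lambda>q. dd f q b) (\<pi> p) (\<pi>' Y))) (at p)" for b
    using smooth_on_has_derivative[OF smooth_on_dd[OF f] D]
    by (intro has_derivative_compose[OF \<pi>, where g="\<lambda>q. dd f q b"])
  have 1: "((\<lambda>q. \<Sum>b\<in>Basis. (W q \<bullet> b) *\<^sub>R dd f (\<pi> q) b) has_derivative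
     (\<lambda>Y. \<Sum>b\<in>Basis. (W p \<bullet> b) *\<^sub>R dd (\<lambda>q. dd f q b) (\<pi> p) (\<pi>' Y) + (W' Y \<bullet> b) *\<^sub>R dd f (\<pi> p) b)) (at p)"
    by (intro has_derivative_sum has_derivative_scaleR has_derivative_inner_left W comp)
  have "((\<lambda>q. \<Sum>b\<in>Basis. (w \<bullet> b) *\<^sub>R dd f q b) has_derivative
     (\<lambda>Y. \<Sum>b\<in>Basis. (w \<bullet> b) *\<^sub>R dd (\<lambda>q. dd f q b) (\<pi> p) Y)) (at (\<pi> p))" for w
    by (intro has_derivative_sum has_derivative_scaleR_right
        smooth_on_has_derivative[OF smooth_on_dd[OF f] D])
  then have 2: "dd (\<lambda>q. dd f q w) (\<pi> p) = (\<lambda>Y. \<Sum>b\<in>Basis. (w \<bullet> b) *\<^sub>R dd (\<lambda>q. dd f q b) (\<pi> p) Y)" for w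
    by (rule dd_eqI[OF has_derivative_transform_within_open[OF _ \<open>open D\<close> D]]) (auto simp: expand)
  have "((\<lambda>q. dd f (\<pi> q) (W q)) has_derivative
     (\<lambda>Y. \<Sum>b\<in>Basis. (W p \<bullet> b) *\<^sub>R dd (\<lambda>q. dd f q b) (\<pi> p) (\<pi>' Y) + (W' Y \<bullet> b) *\<^sub>R dd f (\<pi> p) b)) (at p)"
  proof (rule has_derivative_transform_within_open[OF 1 nbhd(1,2)])
    show "(\<Sum>b\<in>Basis. (W q \<bullet> b) *\<^sub>R dd f (\<pi> q) b) = dd f (\<pi> q) (W q)" if "q \<in> E" for q
      using expand[of "\<pi> q" "W q"] nbhd(3) that by auto
  qed
  moreover have "dd (\<lambda>q. dd f q (W p)) (\<pi> p) (\<pi>' Y) + dd f (\<pi> p) (W' Y) =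
     (\<Sum>b\<in>Basis. (W p \<bullet> b) *\<^sub>R dd (\<lambda>q. dd f q b) (\<pi> p) (\<pi>' Y) + (W' Y \<bullet> b) *\<^sub>R dd f (\<pi> p) b)" for Y
    by (subst expand[OF D, of "W' Y"], subst 2[of "W p"]) (rule sum.distrib[symmetric])
  ultimately show ?thesis
    by simp
qed

section \<open>Determinants, traces and Lorentzian forms\<close>

text \<open>A permutation other than the identity moves at least two indices, so each product-rule
  term of its Leibniz summand still contains an off-diagonal zero.\<close>

lemma det_has_derivative_trace_at_mat_1:
  "(det has_derivative trace) (at (mat 1 :: real ^ 'n::finite ^ 'n))"
proof -
  let ?I = "mat 1 :: real ^ 'n ^ 'n" and ?P = "{p. p permutes (UNIV :: 'n set)}"
  let ?t = "\<lambda>p H i. (H :: real ^ 'n ^ 'n) $ i $ p i * (\<Prod>j\<in>UNIV - {i}. ?I $ j $ p j)"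
  have 1: "((\<lambda>A. \<Sum>p\<in>?P. of_int (sign p) * (\<Prod>i\<in>UNIV. A $ i $ p i)) has_derivative
      (\<lambda>H. \<Sum>p\<in>?P. of_int (sign p) * (\<Sum>i\<in>UNIV. ?t p H i))) (at ?I)"
    by (intro has_derivative_sum has_derivative_mult_right has_derivative_prod)
      (auto intro!: bounded_linear_imp_has_derivative bounded_linear_compose[OF bounded_linear_vec_nth])
  have "(\<Sum>i\<in>UNIV. ?t p H i) = 0" if "p \<in> ?P" "p \<noteq> id" for p H
  proof (rule sum.neutral, safe)
    fix i
    have "\<exists>j. j \<noteq> i \<and> p j \<noteq> j"
    proof (rule ccontr)
      assume *: "\<not> ?thesis"
      have "inj p" using that(1) permutes_inj by blast
      then have "p i = i" using * by (metis injD)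
      then show False using * that(2) by (metis eq_id_iff)
    qed
    then have "(\<Prod>j\<in>UNIV - {i}. ?I $ j $ p j) = 0"
      by (intro prod_zero) (force simp: mat_def)+
    then show "?t p H i = 0" by simp
  qed
  then have "(\<Sum>p\<in>?P. of_int (sign p) * (\<Sum>i\<in>UNIV. ?t p H i)) =
      (\<Sum>p\<in>{id}. of_int (sign p) * (\<Sum>i\<in>UNIV. ?t p H i))" for H
    by (intro sum.mono_neutral_right) (auto simp: permutes_id)
  then have 2: "(\<Sum>p\<in>?P. of_int (sign p) * (\<Sum>i\<in>UNIV. ?t p H i)) = trace H" for H
    by (simp add: trace_def mat_def)
  show ?thesis
    using 1 unfolding 2 det_def[abs_def] .
qed

text \<open>Jacobi's formula: multiplication by the constant matrix J moves the base point to the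
  identity matrix.\<close>

lemma has_derivative_det:
  fixes f :: "'b::real_normed_vector \<Rightarrow> real ^ 'n::finite ^ 'n"
  assumes f: "(f has_derivative f') (at x)" and inv: "J ** f x = mat 1"
  shows "((\<lambda>y. det (f y)) has_derivative (\<lambda>h. det (f x) * trace (J ** f' h))) (at x)"
proof -
  have d: "det J * det (f x) = 1"
    using arg_cong[OF inv, of det] by (simp add: det_mul)
  have e: "det (f y) = det (f x) * det (J ** f y)" for y
    using d by (simp add: det_mul mult.assoc[symmetric] mult.commute)
  have "bounded_linear (\<lambda>A. J ** A)"
    by (auto intro!: linear_conv_bounded_linear[THEN iffD1] linearI
        simp: matrix_matrix_mult_def vec_eq_iff sum_distrib_left sum.distrib algebra_simps)
  from bounded_linear.has_derivative[OF this f]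
  have "((\<lambda>y. det (J ** f y)) has_derivative (\<lambda>h. trace (J ** f' h))) (at x)"
    using has_derivative_compose[of "\<lambda>y. J ** f y" _ x UNIV det trace] det_has_derivative_trace_at_mat_1
    by (simp add: inv)
  then show ?thesis
    by (subst e) (rule has_derivative_mult_right)
qed

section \<open>The trace inequality modulo a null vector\<close>

lemma trace_mult_eq_inner: "trace (A ** B) = transpose A \<bullet> (B :: real ^ 'n::finite ^ 'n)"
  unfolding trace_def matrix_matrix_mult_def inner_vec_def transpose_def
  by simp (rule sum.swap)

lemma trace_similar:
  fixes P :: "real ^ 'n::finite ^ 'n"
  assumes "E ** J = mat 1"
  shows "trace (J ** P ** E) = trace P"
  by (metis assms matrix_mul_assoc matrix_mul_lid trace_mul_sym)

text \<open>Minkowski normal form: u is the timelike basis vector and u + w is null. P kills u + w,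
  maps into its orthogonal complement, and is self-adjoint on the complement of u and w, which
  models the quotient by the null line.\<close>

lemma trace_square_bound_minkowski:
  fixes P :: "real ^ 'n::finite ^ 'n" and w :: "real ^ 'n" and z :: "'n"
  defines "u \<equiv> axis z 1"
  assumes w: "w $ z = 0" "w \<bullet> w = 1"
    and Pw: "P *v w = - (P *v u)" and wP: "\<And>a. w \<bullet> (P *v a) = (P *v a) $ z"
    and sym: "\<And>a b. a $ z = 0 \<Longrightarrow> w \<bullet> a = 0 \<Longrightarrow> b $ z = 0 \<Longrightarrow> w \<bullet> b = 0
      \<Longrightarrow> (P *v a) \<bullet> b = a \<bullet> (P *v b)"
  shows "(trace P)\<^sup>2 \<le> (real CARD('n) - 2) * trace (P ** P)"
proof -
  \<comment> \<open>\<open>Q\<close> projects orthogonally onto the complement of u and w, and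
    \<open>R\<close> compresses P to it. The goal is that \<open>Q \<bullet> R\<close>,
    \<open>R \<bullet> R\<close> and \<open>Q \<bullet> Q\<close> are the trace of P, the trace of
    \<open>P ** P\<close> and n - 2.\<close>
  define Q :: "real ^ 'n ^ 'n" where "Q = (\<chi> i j. (if i = j then 1 else 0) - u $ i * u $ j - w $ i * w $ j)"
  define R where "R = Q ** P ** Q"
  have u: "u \<bullet> u = 1" "u \<bullet> a = a $ z" "a \<bullet> u = a $ z" for a
    by (auto simp: u_def inner_axis inner_axis' inner_commute)
  have Qv: "Q *v a = a - (a $ z) *\<^sub>R u - (w \<bullet> a) *\<^sub>R w" for a
  proof (simp add: vec_eq_iff, rule allI)
    fix i
    have "(Q *v a) $ i = (\<Sum>j\<in>UNIV. (if i = j then a $ j else 0) - u $ i * (u $ j * a $ j) - w $ i * (w $ j * a $ j))"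
      unfolding Q_def matrix_vector_mult_def by (auto intro!: sum.cong simp: algebra_simps)
    also have "\<dots> = a $ i - u $ i * (u \<bullet> a) - w $ i * (w \<bullet> a)"
      by (simp add: sum_subtractf sum_distrib_left[symmetric] inner_vec_def)
    finally show "(Q *v a) $ i = a $ i - a $ z * u $ i - w \<bullet> a * w $ i"
      by (simp add: u)
  qed
  have QT: "transpose Q = Q"
    by (simp add: Q_def transpose_def vec_eq_iff)
  have Qsym: "(Q *v a) \<bullet> b = a \<bullet> (Q *v b)" for a b
    by (metis QT dot_lmul_matrix transpose_matrix_vector)
  have Qz: "(Q *v a) $ z = 0" "w \<bullet> (Q *v a) = 0" for a
    using w by (auto simp: Qv u inner_diff_right) (simp add: u_def)
  have "Q *v (Q *v a) = Q *v a" for a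
    by (subst Qv) (simp add: Qz)
  then have QQ: "Q ** Q = Q"
    by (simp add: matrix_eq matrix_vector_mul_assoc[symmetric])
  have tr: "trace (Q ** X) = trace X - X $ z $ z - w \<bullet> (X *v w)" for X
  proof -
    have "trace (Q ** X) = (\<Sum>i\<in>UNIV. (Q *v column i X) $ i)"
      by (simp add: trace_def matrix_matrix_mult_def matrix_vector_mult_def column_def)
    also have "\<dots> = (\<Sum>i\<in>UNIV. X $ i $ i - X $ z $ i * u $ i - (\<Sum>j\<in>UNIV. w $ j * X $ j $ i * w $ i))"
      by (simp add: Qv column_def inner_vec_def sum_distrib_right)
    also have "\<dots> = trace X - (X *v u) $ z - w \<bullet> (X *v w)"
    proof -
      have "w \<bullet> (X *v w) = (\<Sum>i\<in>UNIV. \<Sum>j\<in>UNIV. w $ j * X $ j $ i * w $ i)"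
        unfolding inner_vec_def matrix_vector_mult_def
        by (simp add: sum_distrib_left mult.assoc) (rule sum.swap)
      then show ?thesis
        by (simp add: sum_subtractf trace_def matrix_vector_mult_def)
    qed
    also have "(X *v u) $ z = X $ z $ z"
      by (simp add: u_def matrix_vector_mul_component inner_axis)
    finally show ?thesis .
  qed
  \<comment> \<open>The two terms that \<open>Q\<close> removes from the trace cancel: w \<bullet> X
    w is the z-component of X w, hence minus that of X u.\<close>
  have tr_eq: "trace (Q ** X) = trace X" if "X *v w = - (X *v u)" "\<And>a. w \<bullet> (X *v a) = (X *v a) $ z" for X
  proof -
    have "(X *v u) $ z = X $ z $ z"
      by (simp add: u_def matrix_vector_mul_component inner_axis)
    then show ?thesis using tr[of X] that(1) that(2)[of w] by simp
  qed
  have lin: "P *v (- a) = - (P *v a)" for a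
    by (metis matrix_vector_mult_diff_distrib matrix_vector_mult_0_right diff_0)
  have trP: "trace (Q ** P) = trace P" and trPP: "trace (Q ** (P ** P)) = trace (P ** P)"
    using Pw wP by (auto intro!: tr_eq simp: matrix_vector_mul_assoc[symmetric] lin)
  \<comment> \<open>On the image of P the projection only subtracts a multiple of u + w, which P
    kills.\<close>
  have "P *v (Q *v (P *v a)) = P *v (P *v a)" for a
    by (simp add: Qv wP matrix_vector_mult_diff_distrib matrix_vector_mult_scaleR Pw)
  then have PQP: "P ** Q ** P = P ** P"
    by (simp add: matrix_eq matrix_vector_mul_assoc[symmetric])
  have trR: "trace R = trace P"
    using trace_mul_sym[of "Q ** P" Q] trP QQ by (simp add: R_def matrix_mul_assoc)
  have "R ** R = Q ** (P ** Q ** P) ** Q"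
    by (metis R_def QQ matrix_mul_assoc)
  then have trRR: "trace (R ** R) = trace (P ** P)"
    using trace_mul_sym[of "Q ** (P ** P)" Q] trPP QQ by (simp add: PQP matrix_mul_assoc)
  have "(R *v a) \<bullet> b = a \<bullet> (R *v b)" for a b
    using sym[of "Q *v a" "Q *v b"] Qz Qsym by (simp add: R_def matrix_vector_mul_assoc[symmetric])
  then have RT: "transpose R = R"
    by (metis (no_types) dot_lmul_matrix inner_commute matrix_eq transpose_matrix_vector vector_eq_ldot)
  have "trace Q = real CARD('n) - 2"
    using tr[of "mat 1"] w by (simp add: trace_I) (simp add: mat_def)
  then have Qn: "Q \<bullet> Q = real CARD('n) - 2"
    using trace_mult_eq_inner[of Q Q] by (simp add: QT QQ)
  have "Q ** R = R" by (simp add: R_def matrix_mul_assoc QQ)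
  then have "Q \<bullet> R = trace P"
    using trace_mult_eq_inner[of Q R] by (simp add: QT trR)
  moreover have "R \<bullet> R = trace (P ** P)"
    using trace_mult_eq_inner[of R R] by (simp add: RT trRR)
  ultimately show ?thesis
    using Cauchy_Schwarz_ineq[of Q R] Qn by simp
qed

text \<open>The columns of E are the diagonalizing basis vectors rescaled to square \<plusminus>1,
  and z marks the one of exceptional sign. The factor \<epsilon> absorbs the choice between the two
  sign conventions.\<close>

lemma lorentzian_diagonalize:
  fixes g :: "real ^ 'n::finite ^ 'n"
  assumes L: "lorentzian (\<lambda>a b. a \<bullet> (g *v b))"
  obtains E J :: "real ^ 'n ^ 'n" and z :: 'n and \<epsilon> :: real
  where "E ** J = mat 1" "J ** E = mat 1" "\<epsilon> = 1 \<or> \<epsilon> = - 1"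
    "\<And>a b. (E *v a) \<bullet> (g *v (E *v b)) = \<epsilon> * (a \<bullet> b - 2 * a $ z * b $ z)"
proof -
  let ?B = "\<lambda>a b. a \<bullet> (g *v b)"
  obtain e :: "'n \<Rightarrow> real ^ 'n" and z \<epsilon> where e: "inj e" "independent (range e)"
    "\<And>i j. i \<noteq> j \<Longrightarrow> ?B (e i) (e j) = 0" "\<And>i. ?B (e i) (e i) \<noteq> 0" and \<epsilon>: "\<epsilon> = 1 \<or> \<epsilon> = - 1"
    and pos: "\<And>i. 0 < \<epsilon> * ?B (e i) (e i) \<longleftrightarrow> i \<noteq> z"
  proof -
    from L consider "has_signature ?B (CARD('n) - 1) 1" | "has_signature ?B 1 (CARD('n) - 1)"
      unfolding lorentzian_def by blast
    then show thesis
    proof cases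
      case 1
      then obtain e :: "'n \<Rightarrow> real ^ 'n" where e: "inj e" "independent (range e)"
        "\<And>i j. i \<noteq> j \<Longrightarrow> ?B (e i) (e j) = 0" "\<And>i. ?B (e i) (e i) \<noteq> 0"
        and c: "card {i. ?B (e i) (e i) < 0} = 1"
        unfolding has_signature_def by blast
      obtain z where "{i. ?B (e i) (e i) < 0} = {z}" using c by (rule card_1_singletonE)
      then have "?B (e i) (e i) < 0 \<longleftrightarrow> i = z" for i by (metis (lifting) mem_Collect_eq singleton_iff)
      then have "0 < 1 * ?B (e i) (e i) \<longleftrightarrow> i \<noteq> z" for i
        using e(4)[of i] by (metis linorder_neqE mult_1 order_less_asym)
      then show thesis using that[OF e, of 1 z] by blast
    next
      case 2
      then obtain e :: "'n \<Rightarrow> real ^ 'n" where e: "inj e" "independent (range e)"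
        "\<And>i j. i \<noteq> j \<Longrightarrow> ?B (e i) (e j) = 0" "\<And>i. ?B (e i) (e i) \<noteq> 0"
        and c: "card {i. 0 < ?B (e i) (e i)} = 1"
        unfolding has_signature_def by blast
      obtain z where "{i. 0 < ?B (e i) (e i)} = {z}" using c by (rule card_1_singletonE)
      then have "0 < ?B (e i) (e i) \<longleftrightarrow> i = z" for i by (metis (lifting) mem_Collect_eq singleton_iff)
      then have "0 < (- 1) * ?B (e i) (e i) \<longleftrightarrow> i \<noteq> z" for i
        using e(4)[of i] by (metis linorder_neqE mult_minus1 neg_0_less_iff_less order_less_asym)
      then show thesis using that[OF e, of "- 1" z] by blast
    qed
  qed
  define d where "d i = sqrt \<bar>?B (e i) (e i)\<bar>" for i
  have d: "d i > 0" "d i * d i = \<bar>?B (e i) (e i)\<bar>" for i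
    using e(4)[of i] by (auto simp: d_def)
  define E :: "real ^ 'n ^ 'n" where "E = (\<chi> a i. e i $ a / d i)"
  have Ev: "E *v a = (\<Sum>i\<in>UNIV. (a $ i / d i) *\<^sub>R e i)" for a
    by (simp add: E_def matrix_vector_mult_def vec_eq_iff mult.commute)
  have "a = 0" if "E *v a = 0" for a
  proof -
    have "(\<Sum>v\<in>range e. (a $ (inv e v) / d (inv e v)) *\<^sub>R v) = (\<Sum>i\<in>UNIV. (a $ i / d i) *\<^sub>R e i)"
      by (subst sum.reindex[OF e(1)]) (simp add: inv_f_f[OF e(1)])
    then have "(\<Sum>v\<in>range e. (a $ (inv e v) / d (inv e v)) *\<^sub>R v) = 0"
      using that Ev by simp
    then have "\<forall>v\<in>range e. a $ (inv e v) / d (inv e v) = 0"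
      using independentD[OF e(2) _ subset_refl, of "\<lambda>v. a $ (inv e v) / d (inv e v)"] by auto
    then have "a $ i / d i = 0" for i
      using inv_f_f[OF e(1)] by (metis rangeI)
    then show ?thesis
      using d(1) by (metis divide_eq_0_iff less_irrefl vec_eq_iff zero_index)
  qed
  then obtain J where J: "J ** E = mat 1"
    using matrix_left_invertible_ker by blast
  have "(E *v a) \<bullet> (g *v (E *v b)) = \<epsilon> * (a \<bullet> b - 2 * a $ z * b $ z)" for a b
  proof -
    have "g *v (E *v b) = (\<Sum>j\<in>UNIV. (b $ j / d j) *\<^sub>R (g *v e j))"
      unfolding Ev by (simp add: linear_sum[OF matrix_vector_mul_linear] matrix_vector_mult_scaleR)
    then have "(E *v a) \<bullet> (g *v (E *v b)) = (\<Sum>i\<in>UNIV. \<Sum>j\<in>UNIV. (a $ i / d i) * (b $ j / d j) * ?B (e i) (e j))"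
      unfolding Ev[of a] inner_sum_left by (simp add: inner_sum_right sum_distrib_left mult_ac)
    also have "\<dots> = (\<Sum>i\<in>UNIV. \<Sum>j\<in>UNIV. if i = j then (a $ i / d i) * (b $ i / d i) * ?B (e i) (e i) else 0)"
      using e(3) by (intro sum.cong) auto
    also have "\<dots> = (\<Sum>i\<in>UNIV. \<epsilon> * (a $ i * b $ i - (if i = z then 2 * a $ i * b $ i else 0)))"
    proof (simp, rule sum.cong, simp)
      fix i
      have "?B (e i) (e i) = (if i = z then - \<epsilon> else \<epsilon>) * (d i * d i)"
        using \<epsilon> pos[of i] e(4)[of i] d(2)[of i] by auto
      then show "a $ i * b $ i * ?B (e i) (e i) / (d i * d i) =
        \<epsilon> * (a $ i * b $ i - (if i = z then 2 * a $ i * b $ i else 0))"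
        using d(1)[of i] by (simp add: field_simps)
    qed
    also have "\<dots> = \<epsilon> * (a \<bullet> b - 2 * a $ z * b $ z)"
      by (simp add: sum_distrib_left[symmetric] sum_subtractf inner_vec_def)
    finally show ?thesis .
  qed
  then show thesis
    using that[OF _ J \<epsilon>] J matrix_left_right_inverse by blast
qed

text \<open>The endomorphism \<open>P\<close> descends to \<open>k\<^sup>\<bottom> / k\<close>, of dimension \<open>n - 2\<close> with definite metric; the
  vanishing of \<open>\<beta> \<and> \<omega>\<close> says that it is self-adjoint there.\<close>

lemma lorentzian_trace_square_bound:
  fixes g P :: "real ^ 'n::finite ^ 'n" and k :: "real ^ 'n"
  defines "\<beta> \<equiv> \<lambda>a. k \<bullet> (g *v a)"
    and "\<omega> \<equiv> \<lambda>a b. (P *v a) \<bullet> (g *v b) - a \<bullet> (g *v (P *v b))"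
  assumes L: "lorentzian (\<lambda>a b. a \<bullet> (g *v b))"
    and k: "k \<noteq> 0" "\<beta> k = 0" and Pk: "P *v k = 0" and kP: "\<And>a. \<beta> (P *v a) = 0"
    and twist: "\<And>a b c. \<beta> a * \<omega> b c + \<beta> b * \<omega> c a + \<beta> c * \<omega> a b = 0"
  shows "(trace P)\<^sup>2 \<le> (real CARD('n) - 2) * trace (P ** P)"
proof -
  obtain E J :: "real ^ 'n ^ 'n" and z \<epsilon> where EJ: "E ** J = mat 1" "J ** E = mat 1"
    and \<epsilon>: "\<epsilon> = 1 \<or> \<epsilon> = - 1"
    and E: "\<And>a b. (E *v a) \<bullet> (g *v (E *v b)) = \<epsilon> * (a \<bullet> b - 2 * a $ z * b $ z)"
    using lorentzian_diagonalize[OF L] by metis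
  define P' where "P' = J ** P ** E"
  define l where "l = J *v k"
  have El: "E *v l = k" by (simp add: l_def matrix_vector_mul_assoc EJ)
  have EP: "E *v (P' *v a) = P *v (E *v a)" for a
    by (simp add: P'_def matrix_vector_mul_assoc matrix_mul_assoc EJ)
  have ll: "l \<bullet> l = 2 * (l $ z * l $ z)"
    using k(2) E[of l l] \<epsilon> by (auto simp: \<beta>_def El)
  have "l \<noteq> 0" using El k(1) by auto
  then have lz: "l $ z \<noteq> 0" using ll by auto
  \<comment> \<open>Nullity forces the timelike coordinate of l to be nonzero, so l is a multiple of
    \<open>w + axis z 1\<close> with w a spacelike unit vector.\<close>
  define w where "w = (1 / l $ z) *\<^sub>R l - axis z 1"
  have lw: "l = l $ z *\<^sub>R (w + axis z 1)" using lz by (simp add: w_def)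
  have wz: "w $ z = 0" using lz by (simp add: w_def)
  have ww: "w \<bullet> w = 1"
    using ll lz by (simp add: w_def inner_diff_left inner_diff_right inner_axis inner_axis' inner_commute)
  have "P' *v l = 0"
    using Pk El by (simp add: P'_def matrix_vector_mul_assoc[symmetric])
  then have "P' *v (w + axis z 1) = 0"
    using lz by (subst (asm) lw) (simp add: matrix_vector_mult_scaleR)
  then have P'w: "P' *v w = - (P' *v axis z 1)"
    by (simp add: matrix_vector_right_distrib eq_neg_iff_add_eq_0)
  have \<beta>E: "\<beta> (E *v a) = \<epsilon> * l $ z * (w \<bullet> a - a $ z)" for a
    using E[of l a] by (simp add: \<beta>_def El)
      (subst lw, simp add: inner_add_left inner_axis' algebra_simps)
  have wP: "w \<bullet> (P' *v a) = (P' *v a) $ z" for a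
    using kP[of "E *v a"] \<beta>E[of "P' *v a"] \<epsilon> lz by (auto simp: EP)
  have sym: "(P' *v a) \<bullet> b = a \<bullet> (P' *v b)"
    if "a $ z = 0" "w \<bullet> a = 0" "b $ z = 0" "w \<bullet> b = 0" for a b
  proof -
    \<comment> \<open>With two arguments in the kernel of \<beta> and the third outside it, a single
      term of \<open>twist\<close> survives.\<close>
    have "\<beta> (E *v a) = 0" "\<beta> (E *v b) = 0" "\<beta> (E *v axis z 1) \<noteq> 0"
      using that \<beta>E \<epsilon> lz wz by (auto simp: inner_axis)
    then have "\<omega> (E *v a) (E *v b) = 0"
      using twist[of "E *v a" "E *v b" "E *v axis z 1"] by simp
    then have "(E *v (P' *v a)) \<bullet> (g *v (E *v b)) = (E *v a) \<bullet> (g *v (E *v (P' *v b)))"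
      by (simp add: \<omega>_def EP)
    then show ?thesis unfolding E using that \<epsilon> by auto
  qed
  have "P' ** P' = J ** (P ** P) ** E"
    unfolding P'_def by (metis EJ(1) matrix_mul_assoc matrix_mul_rid)
  then have "trace (P' ** P') = trace (P ** P)" "trace P' = trace P"
    by (simp_all only: P'_def trace_similar[OF EJ(1)])
  moreover have "(trace P')\<^sup>2 \<le> (real CARD('n) - 2) * trace (P' ** P')"
    by (rule trace_square_bound_minkowski[OF wz ww P'w wP]) (rule sym)
  ultimately show ?thesis by simp
qed

section \<open>The geometry of a homogeneous function in a chart\<close>

lemma linear_expand_axis:
  fixes f :: "real ^ 'n::finite \<Rightarrow> 'b::real_vector"
  assumes "linear f"
  shows "f a = (\<Sum>i\<in>UNIV. a $ i *\<^sub>R f (axis i 1))"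
proof -
  have "f a = f (\<Sum>i\<in>UNIV. a $ i *\<^sub>R axis i 1)"
    using basis_expansion[of a] by (simp add: scalar_mult_eq_scaleR)
  then show ?thesis
    by (simp add: linear_sum[OF assms] linear_cmul[OF assms])
qed

text \<open>The identities are proved on an open set rather than on the hypersurface, so that they
  can be differentiated in every direction; F = 0 enters only with the section.\<close>

locale cone_chart =
  fixes F :: "(real ^ 'n::finite) \<times> (real ^ 'n) \<Rightarrow> real" and D and m :: real
  assumes D: "open D" and F: "smooth_on D F"
    and hom: "\<And>x v r. (x, v) \<in> D \<Longrightarrow> r > 0 \<Longrightarrow> (x, r *\<^sub>R v) \<in> D \<and> F (x, r *\<^sub>R v) = r powr m * F (x, v)"
    and m: "m \<noteq> 1" and nondeg: "\<And>p. p \<in> D \<Longrightarrow> det (gmat F p) \<noteq> 0"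
begin

text \<open>The value of \<alpha> on a vector with horizontal part a. With a fixed it is a scalar
  function on D, open to the calculus above; its fibre derivative \<open>hess\<close> is the
  metric.\<close>

definition fdv :: "real ^ 'n \<Rightarrow> (real ^ 'n) \<times> (real ^ 'n) \<Rightarrow> real" where
  "fdv a q = dd F q (0, a)"

definition hess :: "(real ^ 'n) \<times> (real ^ 'n) \<Rightarrow> real ^ 'n \<Rightarrow> real ^ 'n \<Rightarrow> real" where
  "hess p a b = dd (fdv a) p (0, b)"

lemma fdv_smooth: "smooth_on D (fdv a)"
  unfolding fdv_def by (rule smooth_on_dd[OF F])

lemma dd_fdv_swap: "p \<in> D \<Longrightarrow> dd (fdv a) p Y = dd (\<lambda>q. dd F q Y) p (0, a)"
  unfolding fdv_def by (rule dd_swap[OF F D])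

lemma linear_dd_fdv: "p \<in> D \<Longrightarrow> linear (dd (fdv a) p)"
  by (rule linear_dd[OF fdv_smooth])

lemma linear_dd_fdv_left: "p \<in> D \<Longrightarrow> linear (\<lambda>a. dd (fdv a) p Y)"
  by (simp only: dd_fdv_swap)
    (rule linear_compose[of "\<lambda>a. (0, a)" "dd (\<lambda>q. dd F q Y) p", unfolded o_def];
      auto intro!: linear_dd[OF smooth_on_dd[OF F]] linearI)

lemma hess_sym: "p \<in> D \<Longrightarrow> hess p a b = hess p b a"
  unfolding hess_def dd_fdv_swap[of p a "(0, b)"] by (simp add: fdv_def[abs_def])

lemma hess_bilinear: "p \<in> D \<Longrightarrow> bilinear (hess p)"
  unfolding bilinear_def hess_def
  using linear_dd_fdv_left linear_compose[of "\<lambda>a. (0, a)" "dd (fdv _) p", OF _ linear_dd_fdv]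
  by (simp add: o_def linearI)

lemmas hess_simps = bilinear_ladd[OF hess_bilinear] bilinear_radd[OF hess_bilinear]
  bilinear_lsub[OF hess_bilinear] bilinear_rsub[OF hess_bilinear]
  bilinear_lmul[OF hess_bilinear] bilinear_rmul[OF hess_bilinear]
  bilinear_lneg[OF hess_bilinear] bilinear_rneg[OF hess_bilinear]

lemma gmat_hess: "gmat F p $ i $ j = hess p (axis j 1) (axis i 1)"
  by (simp add: gmat_def hess_def fdv_def[abs_def] vpartial_def[abs_def])

lemma gmat_smooth: "smooth_on D (\<lambda>q. gmat F q $ i $ j)"
  unfolding gmat_hess hess_def by (rule smooth_on_dd[OF fdv_smooth])

lemma gmat_sym: "p \<in> D \<Longrightarrow> transpose (gmat F p) = gmat F p"
  by (simp add: transpose_def vec_eq_iff gmat_hess hess_sym)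

lemma hess_sum:
  assumes "p \<in> D"
  shows "hess p a b = (\<Sum>i\<in>UNIV. \<Sum>j\<in>UNIV. gmat F p $ i $ j * a $ i * b $ j)"
proof -
  have 1: "linear (\<lambda>a. hess p a b)" "linear (hess p a)" for a b
    using hess_bilinear[OF assms] by (auto simp: bilinear_def)
  have "hess p a b = (\<Sum>i\<in>UNIV. \<Sum>j\<in>UNIV. a $ i *\<^sub>R b $ j *\<^sub>R hess p (axis i 1) (axis j 1))"
    by (subst linear_expand_axis[OF 1(1)], subst linear_expand_axis[OF 1(2)])
      (simp add: sum_distrib_left)
  then show ?thesis
    using hess_sym[OF assms] by (simp add: gmat_hess mult_ac)
qed

lemma hess_inner: "p \<in> D \<Longrightarrow> hess p a b = a \<bullet> (gmat F p *v b)"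
  by (simp add: hess_sum inner_vec_def matrix_vector_mult_def sum_distrib_left mult_ac)

lemma g_h_hess: "p \<in> D \<Longrightarrow> g_h F p Y Z = hess p (fst Y) (fst Z)"
  by (simp add: hess_sum g_h_def)

lemma g_v_hess: "p \<in> D \<Longrightarrow> g_v F p Y Z = hess p (snd Y) (snd Z)"
  by (simp add: hess_sum g_v_def)

lemma hess_nondeg: "p \<in> D \<Longrightarrow> (\<And>b. hess p a b = 0) \<Longrightarrow> a = 0"
proof -
  assume p: "p \<in> D" and 0: "\<And>b. hess p a b = 0"
  have "b \<bullet> (gmat F p *v a) = 0" for b
    using 0[of b] p by (metis hess_sym hess_inner)
  then have "gmat F p *v a = 0"
    by (metis inner_eq_zero_iff)
  then show "a = 0"
    using nondeg[OF p] by (metis invertible_det_nz invertible_left_inverse matrix_left_invertible_ker)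
qed

lemma alpha_fdv: "p \<in> D \<Longrightarrow> alpha F p Y = fdv (fst Y) p"
  using linear_expand_axis[OF linear_compose[of "\<lambda>a. (0, a)" "dd F p", unfolded o_def], of "fst Y"]
    linear_dd[OF F]
  by (simp add: alpha_def fdv_def vpartial_def linearI mult.commute)

lemma ext_deriv_alpha:
  assumes p: "p \<in> D"
  shows "ext_deriv (alpha F) p Y Z = dd (fdv (fst Z)) p Y - dd (fdv (fst Y)) p Z"
proof -
  have "dd (\<lambda>q. alpha F q Y) p = dd (fdv (fst Y)) p" for Y
    using dd_cong[OF D p, of "fdv (fst Y)" "\<lambda>q. alpha F q Y"] alpha_fdv
      smooth_on_differentiable[OF fdv_smooth p] by simp
  then show ?thesis by (simp add: ext_deriv_def)
qed

section \<open>Consequences of homogeneity\<close>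

lemma euler:
  assumes p: "p \<in> D"
  shows "dd F p (0, snd p) = m * F p"
proof -
  obtain x v where xv: "p = (x, v)" by fastforce
  have "((\<lambda>r. F (x, r *\<^sub>R v)) has_derivative (\<lambda>r. dd F (x, 1 *\<^sub>R v) (0, r *\<^sub>R v))) (at 1)"
    using smooth_on_has_derivative[OF F p] xv
    by (intro has_derivative_compose[where g=F and f="\<lambda>r. (x, r *\<^sub>R v)"])
      (auto intro!: derivative_eq_intros)
  moreover have "((\<lambda>r. F (x, r *\<^sub>R v)) has_derivative (\<lambda>r. m * F p * r)) (at 1)"
  proof (rule has_derivative_transform_within_open[of "\<lambda>r. r powr m * F p" _ 1 UNIV "{0<..}"])
    show "((\<lambda>r. r powr m * F p) has_derivative (\<lambda>r. m * F p * r)) (at 1)"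
      by (auto intro!: derivative_eq_intros)
  qed (use hom p xv in auto)
  ultimately have "(\<lambda>r. dd F (x, 1 *\<^sub>R v) (0, r *\<^sub>R v)) = (\<lambda>r. m * F p * r)"
    by (rule has_derivative_unique)
  from fun_cong[OF this, of 1] show ?thesis by (simp add: xv)
qed

lemma has_derivative_fibre_coordinate:
  "((\<lambda>q. (0, snd q)) has_derivative (\<lambda>Y. (0, snd Y))) (at p)"
  by (auto intro!: derivative_eq_intros)

lemma dd_fdv_fibre:
  assumes p: "p \<in> D"
  shows "dd (fdv (snd p)) p Y = m * dd F p Y - dd F p (0, snd Y)"
proof -
  have "((\<lambda>q. dd F q (0, snd q)) has_derivative
      (\<lambda>Y. dd (\<lambda>q. dd F q (0, snd p)) p Y + dd F p (0, snd Y))) (at p)"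
    using has_derivative_dd_apply[OF F D p has_derivative_ident has_derivative_fibre_coordinate D p] by simp
  moreover have "((\<lambda>q. dd F q (0, snd q)) has_derivative (\<lambda>Y. m * dd F p Y)) (at p)"
    by (rule has_derivative_transform_within_open[OF
          has_derivative_mult_right[OF smooth_on_has_derivative[OF F p]] D p]) (simp add: euler)
  ultimately have "(\<lambda>Y. dd (\<lambda>q. dd F q (0, snd p)) p Y + dd F p (0, snd Y)) = (\<lambda>Y. m * dd F p Y)"
    by (rule has_derivative_unique)
  from fun_cong[OF this, of Y] show ?thesis by (simp add: fdv_def[abs_def])
qed

text \<open>The vertical case of \<open>dd_fdv_fibre\<close>. It is the bridge between \<alpha> and
  orthogonality to k.\<close>

lemma hess_fibre: "p \<in> D \<Longrightarrow> hess p (snd p) a = (m - 1) * fdv a p"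
  by (simp add: hess_def dd_fdv_fibre) (simp add: fdv_def algebra_simps)

section \<open>The spray and the Euler-Lagrange equation\<close>

text \<open>The right-hand side of the linear system with matrix \<open>gmat\<close> that determines
  the fibre component u of the spray.\<close>

definition force :: "(real ^ 'n) \<times> (real ^ 'n) \<Rightarrow> real ^ 'n" where
  "force q = (\<chi> j. dd F q (axis j 1, 0) - (\<Sum>i\<in>UNIV. snd q $ i * dd (fdv (axis j 1)) q (axis i 1, 0)))"

text \<open>The fibre component of the spray, by Cramer's rule so that its smoothness is visible.\<close>

definition acc :: "(real ^ 'n) \<times> (real ^ 'n) \<Rightarrow> real ^ 'n" where
  "acc q = (\<chi> k. det (\<chi> i j. if j = k then force q $ i else gmat F q $ i $ j) / det (gmat F q))"

lemma acc_smooth: "smooth_on D acc"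
proof -
  have "bounded_linear (\<lambda>q :: (real ^ 'n) \<times> (real ^ 'n). snd q $ i)" for i
    by (rule bounded_linear_compose[OF bounded_linear_vec_nth bounded_linear_snd])
  then have "smooth_on D (\<lambda>q. snd q $ i)" for i
    using smooth_on_bounded_linear[OF D _ smooth_on_ident] by blast
  then have "smooth_on D (\<lambda>q. dd F q (axis j 1, 0) +
      - (\<Sum>i\<in>UNIV. snd q $ i * dd (fdv (axis j 1)) q (axis i 1, 0)))" for j
    by (intro smooth_on_add[OF D] smooth_on_minus[OF D] smooth_on_sum[OF D] smooth_on_mult[OF D]
        smooth_on_dd[OF F] smooth_on_dd[OF fdv_smooth])
  then have "smooth_on D (\<lambda>q. force q $ j)" for j
    by (simp add: force_def)
  then have "smooth_on D (\<lambda>q. (\<chi> i j. if j = k then force q $ i else gmat F q $ i $ j) $ i $ j)" for i j k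
    by (cases "j = k") (simp_all add: gmat_smooth)
  then show ?thesis
    unfolding acc_def
    by (intro smooth_on_vec_lambda[OF D] smooth_on_divide[OF D] smooth_on_det[OF D] gmat_smooth nondeg)
qed

lemma hess_acc:
  assumes p: "p \<in> D"
  shows "hess p a (acc p) = dd F p (a, 0) - dd (fdv a) p (snd p, 0)"
proof -
  have g: "gmat F p *v acc p = force p"
    unfolding cramer[OF nondeg[OF p]] acc_def ..
  have l: "linear (\<lambda>a. dd F p (a, 0))"
    using linear_compose[of "\<lambda>a. (a, 0)" "dd F p"] linear_dd[OF F p] by (simp add: o_def linearI)
  have l': "linear (\<lambda>b. dd (fdv a) p (b, 0))" for a
    using linear_compose[of "\<lambda>a. (a, 0)" "dd (fdv a) p"] linear_dd_fdv[OF p] by (simp add: o_def linearI)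
  have "a \<bullet> force p = (\<Sum>j\<in>UNIV. a $ j * dd F p (axis j 1, 0))
      - (\<Sum>j\<in>UNIV. a $ j * dd (fdv (axis j 1)) p (snd p, 0))"
    using linear_expand_axis[OF l', of _ "snd p"]
    by (simp add: force_def inner_vec_def algebra_simps sum_subtractf)
  then show ?thesis
    using linear_expand_axis[OF l, of a] linear_expand_axis[OF linear_dd_fdv_left[OF p], of a "(snd p, 0)"]
    by (simp add: hess_inner[OF p] g)
qed

lemma dd_fdv_split: "p \<in> D \<Longrightarrow> dd (fdv a) p (b, c) = dd (fdv a) p (b, 0) + hess p a c"
  using linear_add[OF linear_dd_fdv, of p a "(b, 0)" "(0, c)"] by (simp add: hess_def)

lemma euler_lagrange: "p \<in> D \<Longrightarrow> dd (fdv a) p (snd p, acc p) = dd F p (a, 0)"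
  by (subst dd_fdv_split) (simp_all add: hess_acc)

text \<open>Existence combines \<open>euler_lagrange\<close> with \<open>dd_fdv_fibre\<close>.
  Uniqueness is nondegeneracy of d\<alpha>: vertical test vectors kill the horizontal part of a
  kernel vector, then horizontal ones kill its vertical part.\<close>

lemma spray_eq:
  assumes p: "p \<in> D"
  shows "spray F m p = (snd p, acc p)"
  unfolding spray_def
proof (rule the_equality)
  have split: "dd F p Y = dd F p (fst Y, 0) + dd F p (0, snd Y)" for Y
    using linear_add[OF linear_dd[OF F p], of "(fst Y, 0)" "(0, snd Y)"] by simp
  show V: "\<forall>Y. ext_deriv (alpha F) p (snd p, acc p) Y = - (m - 1) * dd F p Y"
  proof
    fix Y
    show "ext_deriv (alpha F) p (snd p, acc p) Y = - (m - 1) * dd F p Y"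
      using split[of Y] by (simp add: ext_deriv_alpha[OF p] euler_lagrange[OF p] dd_fdv_fibre[OF p] algebra_simps)
  qed
  fix W
  assume W: "\<forall>Y. ext_deriv (alpha F) p W Y = - (m - 1) * dd F p Y"
  define Z where "Z = W - (snd p, acc p)"
  have Z: "dd (fdv (fst Y)) p Z = dd (fdv (fst Z)) p Y" for Y
    using spec[OF W, of Y] spec[OF V, of Y]
    by (simp add: ext_deriv_alpha[OF p] Z_def linear_diff[OF linear_dd_fdv[OF p]]
        linear_diff[OF linear_dd_fdv_left[OF p]])
  have "hess p (fst Z) b = 0" for b
    using Z[of "(0, b)"] linear_0[OF linear_dd_fdv_left[OF p], of Z] by (simp add: hess_def)
  then have 1: "fst Z = 0"
    using hess_nondeg[OF p] by blast
  have "hess p a (snd Z) = 0" for a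
    using Z[of "(a, 0)"] linear_0[OF linear_dd_fdv_left[OF p], of "(a, 0)"] 1
    by (simp add: hess_def) (metis prod.collapse)
  then have "snd Z = 0"
    using hess_nondeg[OF p] hess_sym[OF p] by metis
  with 1 have "Z = 0" by (simp add: prod_eq_iff)
  then show "W = (snd p, acc p)" by (simp add: Z_def)
qed

lemma spray_coordinates_has_derivative:
  assumes p: "p \<in> D"
  shows "((\<lambda>q. (snd q, acc q)) has_derivative (\<lambda>Y. (snd Y, dd acc p Y))) (at p)"
  by (intro has_derivative_Pair has_derivative_snd has_derivative_ident
        smooth_on_has_derivative[OF acc_smooth p])

lemma spray_has_derivative:
  assumes p: "p \<in> D"
  shows "(spray F m has_derivative (\<lambda>Y. (snd Y, dd acc p Y))) (at p)"
  by (rule has_derivative_transform_within_open[OF spray_coordinates_has_derivative[OF p] D p])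
    (simp add: spray_eq)

definition acc_v :: "(real ^ 'n) \<times> (real ^ 'n) \<Rightarrow> real ^ 'n \<Rightarrow> real ^ 'n" where
  "acc_v p a = dd acc p (0, a)"

lemma linear_acc_v: "p \<in> D \<Longrightarrow> linear (acc_v p)"
  unfolding acc_v_def
  using linear_compose[of "\<lambda>a. (0, a)" "dd acc p"] linear_dd[OF acc_smooth] by (simp add: o_def linearI)

definition V_hess :: "(real ^ 'n) \<times> (real ^ 'n) \<Rightarrow> real ^ 'n \<Rightarrow> real ^ 'n \<Rightarrow> real" where
  "V_hess p a b = dd (\<lambda>q. hess q a b) p (snd p, acc p)"

lemma V_hess_sym:
  assumes p: "p \<in> D"
  shows "V_hess p a b = V_hess p b a"
proof -
  have "(\<lambda>q. hess q a b) differentiable (at p)"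
    unfolding hess_def by (rule smooth_on_differentiable[OF smooth_on_dd[OF fdv_smooth] p])
  then show ?thesis
    using dd_cong[OF D p, of "\<lambda>q. hess q a b" "\<lambda>q. hess q b a"] hess_sym by (simp add: V_hess_def)
qed

text \<open>Fibre derivative of the Euler--Lagrange equation.\<close>

lemma hess_acc_v:
  assumes p: "p \<in> D"
  shows "hess p a (acc_v p b) = - V_hess p a b + dd (fdv b) p (a, 0) - dd (fdv a) p (b, 0)"
proof -
  have "((\<lambda>q. dd (fdv a) q (snd q, acc q)) has_derivative
      (\<lambda>Y. dd (\<lambda>q. dd (fdv a) q (snd p, acc p)) p Y + dd (fdv a) p (snd Y, dd acc p Y))) (at p)"
    using has_derivative_dd_apply[OF fdv_smooth D p has_derivative_ident spray_coordinates_has_derivative[OF p] D p] by simp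
  moreover have "((\<lambda>q. dd (fdv a) q (snd q, acc q)) has_derivative dd (\<lambda>q. dd F q (a, 0)) p) (at p)"
    by (rule has_derivative_transform_within_open[OF smooth_on_has_derivative[OF smooth_on_dd[OF F] p] D p])
      (simp add: euler_lagrange)
  ultimately have "(\<lambda>Y. dd (\<lambda>q. dd (fdv a) q (snd p, acc p)) p Y + dd (fdv a) p (snd Y, dd acc p Y))
      = dd (\<lambda>q. dd F q (a, 0)) p"
    by (rule has_derivative_unique)
  from fun_cong[OF this, of "(0, b)"]
  have "dd (\<lambda>q. dd (fdv a) q (snd p, acc p)) p (0, b) + dd (fdv a) p (b, acc_v p b) = dd (fdv b) p (a, 0)"
    by (simp add: acc_v_def dd_fdv_swap[OF p, of b])
  moreover have "dd (\<lambda>q. dd (fdv a) q (snd p, acc p)) p (0, b) = V_hess p a b"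
    unfolding V_hess_def hess_def by (rule dd_swap[OF fdv_smooth D p])
  ultimately show ?thesis
    using dd_fdv_split[OF p, of a b "acc_v p b"] by simp
qed

text \<open>The mixed derivatives in \<open>hess_acc_v\<close> are antisymmetric in a and b while
  \<open>V_hess\<close> is symmetric, so averaging the two orders isolates it.\<close>

lemma V_hess_eq: "p \<in> D \<Longrightarrow> V_hess p a b = - (hess p a (acc_v p b) + hess p b (acc_v p a)) / 2"
  using hess_acc_v[of p a b] hess_acc_v[of p b a] V_hess_sym[of p a b] by simp

text \<open>Euler's identity for u, which has degree two. It is read off from
  \<open>hess_acc_v\<close> at b = v, where differentiating \<open>hess_fibre\<close> along the
  spray supplies \<open>V_hess\<close>.\<close>

lemma acc_v_fibre:
  assumes p: "p \<in> D"
  shows "acc_v p (snd p) = 2 *\<^sub>R acc p"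
proof -
  have "hess p a (acc_v p (snd p)) = 2 * hess p a (acc p)" for a
  proof -
    have "((\<lambda>q. dd (fdv a) q (0, snd q)) has_derivative
      (\<lambda>Y. dd (\<lambda>q. dd (fdv a) q (0, snd p)) p Y + dd (fdv a) p (0, snd Y))) (at p)"
      using has_derivative_dd_apply[OF fdv_smooth D p has_derivative_ident has_derivative_fibre_coordinate D p]
      by simp
    moreover have "((\<lambda>q. dd (fdv a) q (0, snd q)) has_derivative (\<lambda>Y. (m - 1) * dd (fdv a) p Y)) (at p)"
    proof (rule has_derivative_transform_within_open[OF
          has_derivative_mult_right[OF smooth_on_has_derivative[OF fdv_smooth p]] D p])
      show "(m - 1) * fdv a q = dd (fdv a) q (0, snd q)" if "q \<in> D" for q
        using hess_fibre[OF that, of a] hess_sym[OF that, of "snd q" a] by (simp add: hess_def)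
    qed
    ultimately have "(\<lambda>Y. dd (\<lambda>q. dd (fdv a) q (0, snd p)) p Y + dd (fdv a) p (0, snd Y))
        = (\<lambda>Y. (m - 1) * dd (fdv a) p Y)"
      by (rule has_derivative_unique)
    from fun_cong[OF this, of "(snd p, acc p)"]
    have "V_hess p a (snd p) = (m - 1) * dd F p (a, 0) - hess p a (acc p)"
      by (simp add: V_hess_def hess_def[abs_def] euler_lagrange[OF p])
    moreover have "dd (fdv (snd p)) p (a, 0) = m * dd F p (a, 0)"
      using linear_0[OF linear_dd[OF F p]] by (simp add: dd_fdv_fibre[OF p] zero_prod_def)
    moreover have "dd (fdv a) p (snd p, 0) = dd F p (a, 0) - hess p a (acc p)"
      by (simp add: hess_acc[OF p])
    ultimately show ?thesis
      by (simp add: hess_acc_v[OF p] algebra_simps)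
  qed
  then have "hess p (acc_v p (snd p) - 2 *\<^sub>R acc p) a = 0" for a
    using p by (simp add: hess_sym[OF p, of _ a] hess_simps)
  then show ?thesis
    using hess_nondeg[OF p] by force
qed

section \<open>Lie derivatives along the spray and the tidal tensor\<close>

lemma lie_bracket_spray_const:
  "p \<in> D \<Longrightarrow> lie_bracket (spray F m) (\<lambda>_. Y) p = - (snd Y, dd acc p Y)"
  using spray_has_derivative[THEN dd_eqI] by (simp add: lie_bracket_def)

lemma P_tensor_eq:
  assumes p: "p \<in> D"
  shows "P_tensor F m p Y = (0, snd Y - (1/2) *\<^sub>R acc_v p (fst Y))"
  by (simp add: P_tensor_def lie_endo_def lie_bracket_spray_const[OF p] lam_def acc_v_def prod_eq_iff
      vec_eq_iff)

text \<open>The brackets supply the vertical components of Y and Z, and \<open>V_hess_eq\<close>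
  supplies \<open>acc_v\<close> with factor -1/2: together the two terms of P.\<close>

lemma lie_bilinear_g_h:
  assumes p: "p \<in> D"
  shows "lie_bilinear (spray F m) (g_h F) p Y Z
    = hess p (fst Z) (snd (P_tensor F m p Y)) + hess p (fst Y) (snd (P_tensor F m p Z))"
proof -
  have "(\<lambda>q. hess q a b) differentiable (at p)" for a b
    unfolding hess_def by (rule smooth_on_differentiable[OF smooth_on_dd[OF fdv_smooth] p])
  then have "dd (\<lambda>q. g_h F q Y Z) p (snd p, acc p) = V_hess p (fst Y) (fst Z)"
    using dd_cong[OF D p, of "\<lambda>q. hess q (fst Y) (fst Z)" "\<lambda>q. g_h F q Y Z"] g_h_hess
    by (simp add: V_hess_def)
  then show ?thesis
    using p by (simp add: lie_bilinear_def spray_eq lie_bracket_spray_const g_h_hess P_tensor_eq V_hess_eq hess_simps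
        hess_sym[OF p, of "snd Y" "fst Z"] field_simps)
qed

text \<open>\<open>DV Y\<close> is minus the bracket of the spray with the constant field Y, and
  \<open>acc2\<close> is the derivative of \<open>acc_v\<close> along the spray. The cancellations
  come later, on vectors tangent to a section, in \<open>tidal_pushforward\<close>.\<close>

lemma tidal_eq:
  assumes p: "p \<in> D"
  defines "acc2 \<equiv> \<lambda>a. dd (\<lambda>q. acc_v q a) p (snd p, acc p)"
    and "P \<equiv> \<lambda>Y. snd (P_tensor F m p Y)" and "DV \<equiv> \<lambda>Y. (snd Y, dd acc p Y)"
  shows "tidal F m p Y Z = (1/2) * (V_hess p (fst Z) (P Y) + V_hess p (fst Y) (P Z)
      - (hess p (fst Z) (acc2 (fst Y)) + hess p (fst Y) (acc2 (fst Z))) / 2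
      + hess p (fst Z) (P (DV Y)) + hess p (snd Y) (P Z) + hess p (snd Z) (P Y) + hess p (fst Y) (P (DV Z)))
      - hess p (P Y) (P Z)"
proof -
  have 1: "((\<lambda>q. hess q c (snd (P_tensor F m q Y))) has_derivative
      (\<lambda>X. dd (\<lambda>q. hess q c (P Y)) p X - hess p c (dd (\<lambda>q. acc_v q (fst Y)) p X) / 2)) (at p)" for c Y
  proof -
    have "((\<lambda>q. dd (fdv c) q (0, snd Y - (1/2) *\<^sub>R acc_v q (fst Y))) has_derivative
        (\<lambda>X. dd (\<lambda>q. dd (fdv c) q (0, snd Y - (1/2) *\<^sub>R acc_v p (fst Y))) p X
           + dd (fdv c) p (0, 0 - (1/2) *\<^sub>R dd (\<lambda>q. acc_v q (fst Y)) p X))) (at p)"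
      unfolding acc_v_def
      by (rule has_derivative_dd_apply[OF fdv_smooth D _ has_derivative_ident _ D p, simplified])
        (intro p has_derivative_Pair has_derivative_diff has_derivative_scaleR_right has_derivative_const
          smooth_on_has_derivative[OF smooth_on_dd[OF acc_smooth] p])+
    then have "((\<lambda>q. dd (fdv c) q (0, snd Y - (1/2) *\<^sub>R acc_v q (fst Y))) has_derivative
      (\<lambda>X. dd (\<lambda>q. hess q c (P Y)) p X - hess p c (dd (\<lambda>q. acc_v q (fst Y)) p X) / 2)) (at p)"
      using p unfolding hess_def[symmetric] by (simp add: P_def P_tensor_eq hess_simps)
    then show ?thesis
      by (rule has_derivative_transform_within_open[OF _ D p]) (simp add: P_tensor_eq hess_def)
  qed
  have "((\<lambda>q. lie_bilinear (spray F m) (g_h F) q Y Z) has_derivative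
    (\<lambda>X. (dd (\<lambda>q. hess q (fst Z) (P Y)) p X - hess p (fst Z) (dd (\<lambda>q. acc_v q (fst Y)) p X) / 2)
       + (dd (\<lambda>q. hess q (fst Y) (P Z)) p X - hess p (fst Y) (dd (\<lambda>q. acc_v q (fst Z)) p X) / 2))) (at p)"
    by (rule has_derivative_transform_within_open[OF has_derivative_add[OF 1 1] D p])
      (simp add: lie_bilinear_g_h)
  from dd_eqI[OF this]
  have 2: "dd (\<lambda>q. lie_bilinear (spray F m) (g_h F) q Y Z) p (snd p, acc p) =
    V_hess p (fst Z) (P Y) + V_hess p (fst Y) (P Z)
      - (hess p (fst Z) (acc2 (fst Y)) + hess p (fst Y) (acc2 (fst Z))) / 2"
    by (simp add: V_hess_def acc2_def field_simps)
  have neg: "P (- Y) = - P Y" for Y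
    using linear_neg[OF linear_acc_v[OF p]] by (simp add: P_def P_tensor_eq[OF p])
  have fold: "snd (P_tensor F m p Y) = P Y" for Y
    by (simp add: P_def)
  show ?thesis
    unfolding tidal_def lie_bilinear_def[of "spray F m" "lie_bilinear (spray F m) (g_h F)"]
    using p neg[of "DV Y", unfolded DV_def] neg[of "DV Z", unfolded DV_def]
    by (simp add: spray_eq 2 lie_bracket_spray_const lie_bilinear_g_h g_v_hess fold DV_def
        hess_simps field_simps)
qed

end

section \<open>The Raychaudhuri equation\<close>

lemma matrix_mult_vec: "linear f \<Longrightarrow> matrix f *v a = f a" for f :: "real ^ 'n \<Rightarrow> real ^ 'm"
  by (metis matrix_vector_mul(2))

lemma trace_matrix: "trace (matrix f) = (\<Sum>i\<in>UNIV. f (axis i 1) $ i)"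
  by (simp add: trace_def matrix_def)

lemma has_real_derivative_abs:
  fixes z :: real
  assumes "z \<noteq> 0"
  shows "(abs has_real_derivative sgn z) (at z)"
proof (cases "z > 0")
  case True
  show ?thesis
    by (rule has_field_derivative_transform_within_open[of "\<lambda>z. z" _ _ "{0<..}"]) (use True in auto)
next
  case False
  show ?thesis
    by (rule has_field_derivative_transform_within_open[of "\<lambda>z. - z" _ _ "{..<0}"])
      (use False assms in \<open>auto intro!: derivative_eq_intros\<close>)
qed

lemma has_derivative_vec_lambda:
  fixes f :: "'i::finite \<Rightarrow> 'b::real_normed_vector \<Rightarrow> 'c::euclidean_space"
  assumes "\<And>i. (f i has_derivative f' i) (at x)"
  shows "((\<lambda>y. \<chi> i. f i y) has_derivative (\<lambda>h. \<chi> i. f' i h)) (at x)"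
proof -
  have vec: "(\<chi> i. v i) = (\<Sum>i\<in>UNIV. axis i (v i))" for v :: "'i \<Rightarrow> 'c"
    by (simp add: vec_eq_iff axis_def)
  have "bounded_linear (axis i :: 'c \<Rightarrow> 'c ^ 'i)" for i
    by (auto intro!: linear_conv_bounded_linear[THEN iffD1] linearI simp: vec_eq_iff axis_def)
  then show ?thesis
    unfolding vec by (intro has_derivative_sum bounded_linear.has_derivative[OF _ assms])
qed

text \<open>The Sachs manifold is no longer visible: its tangent spaces along the section are the
  ranges of \<open>pushforward\<close>, so its defining properties become conditions on
  \<sigma>.\<close>

locale sachs_chart = cone_chart F D m
  for F :: "(real ^ 'n::finite) \<times> (real ^ 'n) \<Rightarrow> real" and D and m :: real +
  fixes S :: "(real ^ 'n) set" and \<sigma> :: "real ^ 'n \<Rightarrow> real ^ 'n"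
  assumes S: "open S" and \<sigma>: "smooth_on S \<sigma>"
    and in_D: "\<And>x. x \<in> S \<Longrightarrow> (x, \<sigma> x) \<in> D"
    and null: "\<And>x. x \<in> S \<Longrightarrow> F (x, \<sigma> x) = 0"
    and nonzero: "\<And>x. x \<in> S \<Longrightarrow> \<sigma> x \<noteq> 0"
    and tangent: "\<And>x. x \<in> S \<Longrightarrow> pushforward \<sigma> x (\<sigma> x) = spray F m (x, \<sigma> x)"
    and integrable: "\<And>x a b c. x \<in> S \<Longrightarrow> wedge12 (alpha F (x, \<sigma> x)) (ext_deriv (alpha F) (x, \<sigma> x))
      (pushforward \<sigma> x a) (pushforward \<sigma> x b) (pushforward \<sigma> x c) = 0"
begin

definition P_s :: "real ^ 'n \<Rightarrow> real ^ 'n \<Rightarrow> real ^ 'n" where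
  "P_s x a = dd \<sigma> x a - (1/2) *\<^sub>R acc_v (x, \<sigma> x) a"

lemma linear_P_s: "x \<in> S \<Longrightarrow> linear (P_s x)"
  unfolding P_s_def[abs_def]
  by (intro linear_compose_sub linear_compose_scale_right linear_dd[OF \<sigma>] linear_acc_v in_D)

text \<open>The vertical part b is arbitrary because \<open>DV\<close> of a pushforward is in
  general not a pushforward.\<close>

lemma P_tensor_pushforward: "x \<in> S \<Longrightarrow> snd (P_tensor F m (x, \<sigma> x) (a, b)) = b - dd \<sigma> x a + P_s x a"
  by (simp add: P_tensor_eq in_D P_s_def)

lemma acc_v_P_s: "acc_v (x, \<sigma> x) a = 2 *\<^sub>R (dd \<sigma> x a - P_s x a)"
  by (simp add: P_s_def)

lemma geodesic: "x \<in> S \<Longrightarrow> dd \<sigma> x (\<sigma> x) = acc (x, \<sigma> x)"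
  using tangent by (simp add: pushforward_def spray_eq in_D)

lemma congruence_field_eq: "x \<in> S \<Longrightarrow> congruence_field F m \<sigma> x = \<sigma> x"
  unfolding congruence_field_def
  by (rule the_equality) (simp add: tangent, simp add: pushforward_def spray_eq in_D)

lemma section_has_derivative: "x \<in> S \<Longrightarrow> ((\<lambda>y. (y, \<sigma> y)) has_derivative (\<lambda>a. (a, dd \<sigma> x a))) (at x)"
  by (intro has_derivative_Pair has_derivative_ident smooth_on_has_derivative[OF \<sigma>])

lemma section_compose_has_derivative:
  assumes x: "x \<in> S" and h: "smooth_on D h"
  shows "((\<lambda>y. h (y, \<sigma> y)) has_derivative (\<lambda>a. dd h (x, \<sigma> x) (a, dd \<sigma> x a))) (at x)"
  using smooth_on_has_derivative[OF h in_D[OF x]]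
  by (intro has_derivative_compose[OF section_has_derivative[OF x], where g=h])

section \<open>Kernel, image and self-adjointness of \<open>P_s\<close>\<close>

text \<open>The geodesic equation gives d\<sigma>(k) = u, and by \<open>acc_v_fibre\<close> half of
  the fibre derivative of u, applied to k, is u as well.\<close>

lemma P_s_k: "x \<in> S \<Longrightarrow> P_s x (\<sigma> x) = 0"
  using acc_v_fibre[OF in_D, of x] by (simp add: P_s_def geodesic)

text \<open>The mixed derivatives of F left by \<open>ext_deriv_alpha\<close> are given by the
  antisymmetric part of \<open>hess_acc_v\<close>, which replaces them by
  \<open>acc_v\<close>.\<close>

lemma ext_deriv_alpha_pushforward:
  assumes x: "x \<in> S"
  shows "ext_deriv (alpha F) (x, \<sigma> x) (pushforward \<sigma> x a) (pushforward \<sigma> x b)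
    = hess (x, \<sigma> x) (P_s x a) b - hess (x, \<sigma> x) a (P_s x b)"
  using in_D[OF x] hess_acc_v[OF in_D[OF x], of a b] hess_acc_v[OF in_D[OF x], of b a]
    V_hess_sym[OF in_D[OF x], of a b]
    dd_fdv_split[OF in_D[OF x], of a b "dd \<sigma> x b"] dd_fdv_split[OF in_D[OF x], of b a "dd \<sigma> x a"]
  by (simp add: ext_deriv_alpha pushforward_def acc_v_P_s hess_simps hess_sym[of "(x, \<sigma> x)" _ b])

text \<open>Homogeneity gives g(v, v) = m (m - 1) F.\<close>

lemma hess_k_k: "x \<in> S \<Longrightarrow> hess (x, \<sigma> x) (\<sigma> x) (\<sigma> x) = 0"
  using hess_fibre[OF in_D, of x "\<sigma> x"] euler[OF in_D, of x] null[of x] by (simp add: fdv_def)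

text \<open>Two evaluations of d\<alpha> on k and a: the spray equation yields a multiple of dF,
  which vanishes along the section, while \<open>ext_deriv_alpha_pushforward\<close> and
  \<open>P_s_k\<close> yield -g(k, P_s a).\<close>

lemma hess_k_P_s:
  assumes x: "x \<in> S"
  shows "hess (x, \<sigma> x) (\<sigma> x) (P_s x a) = 0"
proof -
  have "((\<lambda>y. F (y, \<sigma> y)) has_derivative (\<lambda>a. 0)) (at x)"
    by (rule has_derivative_transform_within_open[OF has_derivative_const S x]) (simp add: null)
  from fun_cong[OF has_derivative_unique[OF section_compose_has_derivative[OF x F] this], of a]
  have dF: "dd F (x, \<sigma> x) (a, dd \<sigma> x a) = 0" .
  have sp: "pushforward \<sigma> x (\<sigma> x) = (\<sigma> x, acc (x, \<sigma> x))"
    by (simp add: pushforward_def geodesic x)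
  have "ext_deriv (alpha F) (x, \<sigma> x) (pushforward \<sigma> x (\<sigma> x)) (pushforward \<sigma> x a)
     = dd F (x, \<sigma> x) (a, 0) - (m * dd F (x, \<sigma> x) (a, dd \<sigma> x a) - dd F (x, \<sigma> x) (0, dd \<sigma> x a))"
    using euler_lagrange[OF in_D[OF x], of a] dd_fdv_fibre[OF in_D[OF x], of "(a, dd \<sigma> x a)"]
    by (simp add: ext_deriv_alpha in_D x sp) (simp add: pushforward_def)
  also have "\<dots> = 0"
    using dF linear_add[OF linear_dd[OF F in_D[OF x]], of "(a, 0)" "(0, dd \<sigma> x a)"] by simp
  finally show ?thesis
    using bilinear_lzero[OF hess_bilinear[OF in_D[OF x]]]
    by (simp add: ext_deriv_alpha_pushforward x P_s_k)
qed

lemma alpha_pushforward: "x \<in> S \<Longrightarrow> (m - 1) * alpha F (x, \<sigma> x) (pushforward \<sigma> x a) = hess (x, \<sigma> x) (\<sigma> x) a"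
  using hess_fibre[OF in_D, of x a] by (simp add: alpha_fdv in_D pushforward_def)

lemma trace_P_s_square_bound:
  assumes x: "x \<in> S" and L: "lorentzian (\<lambda>a b. g_v F (x, \<sigma> x) (0, a) (0, b))"
  shows "(trace (matrix (P_s x)))\<^sup>2 \<le> (real CARD('n) - 2) * trace (matrix (P_s x) ** matrix (P_s x))"
proof (rule lorentzian_trace_square_bound[where k = "\<sigma> x" and g = "gmat F (x, \<sigma> x)"])
  let ?p = "(x, \<sigma> x)"
  let ?\<omega> = "\<lambda>a b. hess ?p (P_s x a) b - hess ?p a (P_s x b)"
  note D = in_D[OF x]
  note [simp] = matrix_mult_vec[OF linear_P_s[OF x]] hess_inner[OF D, symmetric]
  show "lorentzian (\<lambda>a b. a \<bullet> (gmat F ?p *v b))"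
    using L by (simp add: g_v_hess[OF D])
  show "\<sigma> x \<noteq> 0" "\<sigma> x \<bullet> (gmat F ?p *v \<sigma> x) = 0" "matrix (P_s x) *v \<sigma> x = 0"
    "\<sigma> x \<bullet> (gmat F ?p *v (matrix (P_s x) *v a)) = 0" for a
    using x by (simp_all add: nonzero hess_k_k P_s_k hess_k_P_s)
  fix a b c
  \<comment> \<open>The factor m - 1 converts \<alpha> into the metric dual of k, the form \<beta>
    of \<open>lorentzian_trace_square_bound\<close>.\<close>
  have "(m - 1) * wedge12 (alpha F ?p) (ext_deriv (alpha F) ?p)
      (pushforward \<sigma> x a) (pushforward \<sigma> x b) (pushforward \<sigma> x c)
    = hess ?p (\<sigma> x) a * ?\<omega> b c + hess ?p (\<sigma> x) b * ?\<omega> c a + hess ?p (\<sigma> x) c * ?\<omega> a b"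
    unfolding wedge12_def ext_deriv_alpha_pushforward[OF x] alpha_pushforward[OF x, symmetric]
    by (simp add: algebra_simps)
  then show "\<sigma> x \<bullet> (gmat F ?p *v a) * ((matrix (P_s x) *v b) \<bullet> (gmat F ?p *v c) - b \<bullet> (gmat F ?p *v (matrix (P_s x) *v c)))
    + \<sigma> x \<bullet> (gmat F ?p *v b) * ((matrix (P_s x) *v c) \<bullet> (gmat F ?p *v a) - c \<bullet> (gmat F ?p *v (matrix (P_s x) *v a)))
    + \<sigma> x \<bullet> (gmat F ?p *v c) * ((matrix (P_s x) *v a) \<bullet> (gmat F ?p *v b) - a \<bullet> (gmat F ?p *v (matrix (P_s x) *v b))) = 0"
    using integrable[OF x, of a b c] by simp
qed

section \<open>The divergence as a trace\<close>

lemma volume_density_eq: "y \<in> S \<Longrightarrow> volume_density F \<sigma> y = sqrt \<bar>det (gmat F (y, \<sigma> y))\<bar>"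
proof -
  assume y: "y \<in> S"
  have "(\<chi> i j. g_s F \<sigma> y (axis i 1) (axis j 1)) = gmat F (y, \<sigma> y)"
    using in_D[OF y] by (simp add: vec_eq_iff g_s_def g_h_hess pushforward_def gmat_hess hess_sym)
  then show ?thesis by (simp add: volume_density_def)
qed

lemma volume_density_pos: "x \<in> S \<Longrightarrow> volume_density F \<sigma> x > 0"
  using nondeg[OF in_D] by (simp add: volume_density_eq)

lemma gmat_inverse:
  assumes "x \<in> S"
  obtains J where "J ** gmat F (x, \<sigma> x) = mat 1" "gmat F (x, \<sigma> x) ** J = mat 1"
  using nondeg[OF in_D[OF assms]] by (metis invertible_def invertible_det_nz)

text \<open>For symmetric G with inverse J, \<open>J ** transpose A ** G\<close> is the adjoint of A
  with respect to G.\<close>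

lemma trace_adjoint:
  fixes J G A :: "real ^ 'n ^ 'n"
  assumes "G ** J = mat 1"
  shows "trace (J ** transpose A ** G) = trace A"
  using trace_similar[OF assms, of "transpose A"] by (simp add: trace_def transpose_def)

text \<open>The section carries k to the spray, so \<open>V_hess_eq\<close> expresses the change of
  the metric through \<open>acc_v\<close> and its adjoint, which have equal traces. Jacobi's formula
  and the square root give the factor.\<close>

lemma volume_density_derivative:
  assumes x: "x \<in> S"
  shows "dd (volume_density F \<sigma>) x (\<sigma> x) = - (1/2) * trace (matrix (acc_v (x, \<sigma> x))) * volume_density F \<sigma> x"
proof -
  let ?p = "(x, \<sigma> x)" let ?G = "gmat F ?p" let ?C = "matrix (acc_v ?p)" let ?d = "det ?G"
  note D = in_D[OF x]
  obtain J where J: "J ** ?G = mat 1" "?G ** J = mat 1"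
    using gmat_inverse[OF x] .
  define G' where "G' a = (\<chi> i j. dd (\<lambda>q. gmat F q $ i $ j) ?p (a, dd \<sigma> x a))" for a
  have "((\<lambda>y. \<chi> i j. gmat F (y, \<sigma> y) $ i $ j) has_derivative G') (at x)"
    unfolding G'_def by (intro has_derivative_vec_lambda section_compose_has_derivative[OF x gmat_smooth])
  then have "((\<lambda>y. gmat F (y, \<sigma> y)) has_derivative G') (at x)"
    by simp
  from has_derivative_det[OF this J(1)]
  have d: "((\<lambda>y. det (gmat F (y, \<sigma> y))) has_derivative (\<lambda>h. ?d * trace (J ** G' h))) (at x)" .
  have "((\<lambda>y. \<bar>det (gmat F (y, \<sigma> y))\<bar>) has_derivative
      (\<lambda>h. sgn ?d * (?d * trace (J ** G' h)))) (at x)"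
    using DERIV_compose_FDERIV[OF has_real_derivative_abs[OF nondeg[OF D]] d] by (simp add: mult_ac)
  then have "((\<lambda>y. sqrt \<bar>det (gmat F (y, \<sigma> y))\<bar>) has_derivative
      (\<lambda>h. sgn ?d * (?d * trace (J ** G' h)) * inverse (sqrt \<bar>?d\<bar>) / 2)) (at x)"
    using nondeg[OF D] by (auto intro!: derivative_eq_intros simp: fun_eq_iff field_simps)
  then have vd: "(volume_density F \<sigma> has_derivative
      (\<lambda>h. sgn ?d * (?d * trace (J ** G' h)) * inverse (sqrt \<bar>?d\<bar>) / 2)) (at x)"
    by (rule has_derivative_transform_within_open[OF _ S x]) (simp add: volume_density_eq)
  have "sgn ?d * (?d * t) = \<bar>?d\<bar> * t" for t
    by (simp add: sgn_if abs_if)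
  then have "dd (volume_density F \<sigma>) x (\<sigma> x) = \<bar>?d\<bar> * trace (J ** G' (\<sigma> x)) * inverse (sqrt \<bar>?d\<bar>) / 2"
    by (simp only: dd_eqI[OF vd])
  also have "\<dots> = \<bar>?d\<bar> / sqrt \<bar>?d\<bar> / 2 * trace (J ** G' (\<sigma> x))"
    by (simp only: divide_inverse mult_ac)
  also have "\<bar>?d\<bar> / sqrt \<bar>?d\<bar> = sqrt \<bar>?d\<bar>"
    by (rule real_div_sqrt) simp
  also have "G' (\<sigma> x) = - (1/2) *\<^sub>R (?G ** ?C + transpose ?C ** ?G)"
  proof -
    have lin: "axis i 1 \<bullet> (?G *v acc_v ?p (axis j 1)) = (?G ** ?C) $ i $ j" for i j
      unfolding matrix_mult_vec[OF linear_acc_v[OF D], of "axis j 1", symmetric]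
      by (simp add: inner_axis' matrix_vector_mult_basis)
        (simp add: column_def matrix_vector_mult_def matrix_matrix_mult_def)
    have "G' (\<sigma> x) $ i $ j = V_hess ?p (axis j 1) (axis i 1)" for i j
      by (simp add: G'_def gmat_hess V_hess_def geodesic x)
    moreover have "(transpose ?C ** ?G) $ i $ j = (?G ** ?C) $ j $ i" for i j
    proof -
      have "transpose ?C ** ?G = transpose (?G ** ?C)"
        by (simp add: matrix_transpose_mul gmat_sym[OF D])
      then show ?thesis by (simp add: transpose_def)
    qed
    ultimately show ?thesis
      by (simp add: vec_eq_iff V_hess_eq[OF D] hess_inner[OF D] lin field_simps)
  qed
  also have "trace (J ** (- (1/2) *\<^sub>R (?G ** ?C + transpose ?C ** ?G))) = - trace ?C"
  proof -
    have "trace (J ** (c *\<^sub>R B)) = c * trace (J ** B)" for B c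
      by (simp add: trace_def matrix_matrix_mult_def sum_distrib_left mult_ac)
    moreover have "trace (J ** (?G ** ?C)) = trace ?C"
      by (simp add: matrix_mul_assoc J)
    moreover have "trace (J ** (transpose ?C ** ?G)) = trace ?C"
      using trace_adjoint[OF J(2)] by (simp add: matrix_mul_assoc)
    ultimately show ?thesis
      by (simp only: matrix_add_ldistrib trace_add) simp
  qed
  finally show ?thesis
    by (simp add: volume_density_eq x)
qed

lemma divergence_eq_trace:
  assumes x: "x \<in> S"
  shows "lie_density (congruence_field F m \<sigma>) (volume_density F \<sigma>) x
    = trace (matrix (P_s x)) * volume_density F \<sigma> x"
proof -
  have "dd (congruence_field F m \<sigma>) x = dd \<sigma> x"
    using dd_cong[OF S x, of \<sigma> "congruence_field F m \<sigma>"] smooth_on_differentiable[OF \<sigma> x]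
      congruence_field_eq by simp
  moreover have "trace (matrix (dd \<sigma> x)) = trace (matrix (P_s x)) + trace (matrix (acc_v (x, \<sigma> x))) / 2"
    by (simp add: trace_matrix P_s_def sum_subtractf sum_divide_distrib)
  ultimately show ?thesis
    by (simp add: lie_density_def congruence_field_eq x volume_density_derivative algebra_simps)
qed

section \<open>Evolution of \<open>P_s\<close> along the congruence\<close>

text \<open>The derivative of the components of \<open>P_s\<close> along k, which depends on the
  chart; the commutator with d\<sigma> in \<open>riccati\<close> completes it to the Lie
  derivative.\<close>

definition P_dot :: "real ^ 'n \<Rightarrow> real ^ 'n \<Rightarrow> real ^ 'n" where
  "P_dot x a = dd (\<lambda>y. dd \<sigma> y a) x (\<sigma> x)
     - (1/2) *\<^sub>R dd (\<lambda>q. acc_v q a) (x, \<sigma> x) (\<sigma> x, acc (x, \<sigma> x))"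

lemma linear_P_dot:
  assumes x: "x \<in> S"
  shows "linear (P_dot x)"
proof -
  have "linear (\<lambda>a. dd (\<lambda>y. dd \<sigma> y a) x k)" for k
    by (simp only: dd_swap[OF \<sigma> S x, of _ k] linear_dd[OF smooth_on_dd[OF \<sigma>] x] eta_contract_eq)
  moreover have "linear (\<lambda>a. dd (\<lambda>q. acc_v q a) (x, \<sigma> x) V)" for V
    unfolding acc_v_def dd_swap[OF acc_smooth D in_D[OF x], of _ V]
    using linear_compose[of "\<lambda>a. (0, a)" "dd (\<lambda>q. dd acc q V) (x, \<sigma> x)"]
      linear_dd[OF smooth_on_dd[OF acc_smooth] in_D[OF x]] by (simp add: o_def linearI)
  ultimately show ?thesis
    unfolding P_dot_def[abs_def] by (intro linear_compose_sub linear_compose_scale_right)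
qed

lemma trace_P_s_has_derivative:
  assumes x: "x \<in> S"
  obtains T where "((\<lambda>y. trace (matrix (P_s y))) has_derivative T) (at x)"
    "T (\<sigma> x) = trace (matrix (P_dot x))"
proof -
  have "((\<lambda>y. P_s y a) has_derivative (\<lambda>h. dd (\<lambda>y. dd \<sigma> y a) x h
      - (1/2) *\<^sub>R dd (\<lambda>q. acc_v q a) (x, \<sigma> x) (h, dd \<sigma> x h))) (at x)" for a
    unfolding P_s_def acc_v_def
    by (intro has_derivative_diff has_derivative_scaleR_right smooth_on_has_derivative[OF smooth_on_dd[OF \<sigma>] x]
        section_compose_has_derivative[OF x smooth_on_dd[OF acc_smooth]])
  then have "((\<lambda>y. trace (matrix (P_s y))) has_derivative
     (\<lambda>h. \<Sum>i\<in>UNIV. (dd (\<lambda>y. dd \<sigma> y (axis i 1)) x h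
      - (1/2) *\<^sub>R dd (\<lambda>q. acc_v q (axis i 1)) (x, \<sigma> x) (h, dd \<sigma> x h)) $ i)) (at x)"
    unfolding trace_matrix
    by (intro has_derivative_sum bounded_linear.has_derivative[OF bounded_linear_vec_nth])
  then show thesis
    using that by (simp add: trace_matrix P_dot_def geodesic x)
qed

text \<open>The geodesic equation differentiated along the section, with the second derivatives of
  \<sigma> exchanged. It removes the position derivatives of u from the tidal tensor.\<close>

lemma dd_acc_pushforward:
  assumes x: "x \<in> S"
  shows "dd acc (x, \<sigma> x) (a, dd \<sigma> x a) = dd (\<lambda>y. dd \<sigma> y a) x (\<sigma> x) + dd \<sigma> x (dd \<sigma> x a)"
proof -
  have "((\<lambda>y. dd \<sigma> y (\<sigma> y)) has_derivative (\<lambda>a. dd (\<lambda>y. dd \<sigma> y (\<sigma> x)) x a + dd \<sigma> x (dd \<sigma> x a))) (at x)"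
    using has_derivative_dd_apply[OF \<sigma> S x has_derivative_ident smooth_on_has_derivative[OF \<sigma> x] S x] by simp
  moreover have "((\<lambda>y. dd \<sigma> y (\<sigma> y)) has_derivative (\<lambda>a. dd acc (x, \<sigma> x) (a, dd \<sigma> x a))) (at x)"
    by (rule has_derivative_transform_within_open[OF section_compose_has_derivative[OF x acc_smooth] S x])
      (simp add: geodesic)
  ultimately have "(\<lambda>a. dd (\<lambda>y. dd \<sigma> y (\<sigma> x)) x a + dd \<sigma> x (dd \<sigma> x a))
      = (\<lambda>a. dd acc (x, \<sigma> x) (a, dd \<sigma> x a))"
    by (rule has_derivative_unique)
  from fun_cong[OF this, of a] show ?thesis
    by (simp add: dd_swap[OF \<sigma> S x, of a])
qed

text \<open>The square of \<open>P_s\<close> plus its Lie derivative along k, written in the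
  chart.\<close>

definition riccati :: "real ^ 'n \<Rightarrow> real ^ 'n \<Rightarrow> real ^ 'n" where
  "riccati x a = P_s x (P_s x a) + P_s x (dd \<sigma> x a) - dd \<sigma> x (P_s x a) + P_dot x a"

text \<open>The first Lie derivative of the metric symmetrizes \<open>P_s\<close>. Half of the
  second consists of g(P_s a, P_s b), which the definition of the tidal tensor subtracts, and the
  symmetric part of \<open>riccati\<close>.\<close>

lemma tidal_pushforward:
  assumes x: "x \<in> S"
  shows "tidal F m (x, \<sigma> x) (pushforward \<sigma> x a) (pushforward \<sigma> x b)
    = (hess (x, \<sigma> x) (riccati x a) b + hess (x, \<sigma> x) a (riccati x b)) / 2"
proof -
  let ?p = "(x, \<sigma> x)"
  note D = in_D[OF x]
  have sym: "hess ?p b c = hess ?p c b" "hess ?p a c = hess ?p c a" for c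
    using hess_sym[OF D] by auto
  have acc2: "dd (\<lambda>q. acc_v q a) ?p (\<sigma> x, acc ?p) = 2 *\<^sub>R (dd (\<lambda>y. dd \<sigma> y a) x (\<sigma> x) - P_dot x a)" for a
    by (simp add: P_dot_def)
  show ?thesis
    unfolding pushforward_def tidal_eq[OF D]
    using D x hess_sym[OF D, of "P_s x b" "P_s x a"] hess_sym[OF D, of "dd \<sigma> x b" "P_s x a"]
      hess_sym[OF D, of "dd \<sigma> x a" "P_s x b"]
    by (simp add: acc2 P_tensor_pushforward dd_acc_pushforward V_hess_eq acc_v_P_s riccati_def hess_simps sym field_simps)
qed

lemma trace_riccati:
  assumes x: "x \<in> S"
  shows "trace (matrix (riccati x)) = trace (matrix (P_s x) ** matrix (P_s x)) + trace (matrix (P_dot x))"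
proof -
  let ?B = "matrix (dd \<sigma> x)" let ?P = "matrix (P_s x)"
  have "riccati x a = (?P ** ?P + ?P ** ?B - ?B ** ?P + matrix (P_dot x)) *v a" for a
    using linear_P_s[OF x] linear_dd[OF \<sigma> x] linear_P_dot[OF x]
    by (simp add: riccati_def matrix_vector_mult_add_rdistrib matrix_vector_mult_diff_rdistrib
        matrix_vector_mul_assoc[symmetric] matrix_mult_vec)
  then have "matrix (riccati x) = ?P ** ?P + ?P ** ?B - ?B ** ?P + matrix (P_dot x)"
    by (metis (no_types, lifting) ext matrix_of_matrix_vector_mul)
  then show ?thesis
    using trace_mul_sym[of ?P ?B] by (simp add: trace_add trace_sub)
qed

lemma linear_riccati: "x \<in> S \<Longrightarrow> linear (riccati x)"
  unfolding riccati_def[abs_def]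
  using linear_compose[OF linear_P_s linear_P_s] linear_compose[OF linear_P_s linear_dd[OF \<sigma>]]
    linear_compose[OF linear_dd[OF \<sigma>] linear_P_s]
  by (intro linear_compose_sub linear_compose_add linear_P_dot) (simp_all add: o_def)

text \<open>\<open>S_sharp\<close> is the mean of \<open>riccati\<close> and its metric adjoint, and
  the adjoint has the same trace.\<close>

lemma trace_S_sharp:
  assumes x: "x \<in> S"
  shows "trace (matrix (S_sharp F m \<sigma> x)) = trace (matrix (riccati x))"
proof -
  let ?p = "(x, \<sigma> x)" let ?G = "gmat F ?p" let ?Q = "matrix (riccati x)"
  note D = in_D[OF x]
  obtain J where J: "J ** ?G = mat 1" "?G ** J = mat 1"
    using gmat_inverse[OF x] .
  have S: "S_sharp F m \<sigma> x a = ((1/2) *\<^sub>R (?Q + J ** transpose ?Q ** ?G)) *v a" (is "_ = ?W a") for a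
    unfolding S_sharp_def
  proof (rule the_equality)
    have *: "g_s F \<sigma> x W Z = hess ?p W Z" for W Z
      by (simp add: g_s_def g_h_hess[OF D] pushforward_def)
    have "hess ?p (J *v (transpose ?Q *v (?G *v a))) Z = hess ?p a (riccati x Z)" for Z
    proof -
      have "hess ?p (J *v (transpose ?Q *v (?G *v a))) Z = Z \<bullet> (?G *v (J *v (transpose ?Q *v (?G *v a))))"
        by (metis D hess_inner hess_sym)
      also have "?G *v (J *v (transpose ?Q *v (?G *v a))) = transpose ?Q *v (?G *v a)"
        by (simp add: matrix_vector_mul_assoc matrix_mul_assoc J)
      also have "Z \<bullet> \<dots> = (?Q *v Z) \<bullet> (?G *v a)"
        by (metis dot_lmul_matrix inner_commute transpose_matrix_vector)
      also have "\<dots> = hess ?p a (riccati x Z)"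
        by (metis D hess_inner hess_sym linear_riccati matrix_mult_vec x)
      finally show ?thesis .
    qed
    then show W: "\<forall>Z. g_s F \<sigma> x (?W a) Z = tidal F m ?p (pushforward \<sigma> x a) (pushforward \<sigma> x Z)"
      unfolding * tidal_pushforward[OF x]
      by (simp add: scaleR_matrix_vector_assoc[symmetric] matrix_vector_mult_add_rdistrib hess_simps[OF D]
          matrix_vector_mul_assoc[symmetric] matrix_mult_vec linear_riccati x)
    fix W assume "\<forall>Z. g_s F \<sigma> x W Z = tidal F m ?p (pushforward \<sigma> x a) (pushforward \<sigma> x Z)"
    then have "hess ?p (W - ?W a) Z = 0" for Z
      using W unfolding * by (simp add: bilinear_lsub[OF hess_bilinear[OF D]])
    then show "W = ?W a"
      using hess_nondeg[OF D] by (metis eq_iff_diff_eq_0)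
  qed
  have "S_sharp F m \<sigma> x = (\<lambda>a. ((1/2) *\<^sub>R (?Q + J ** transpose ?Q ** ?G)) *v a)"
    using S by blast
  then have "matrix (S_sharp F m \<sigma> x) = (1/2) *\<^sub>R (?Q + J ** transpose ?Q ** ?G)"
    by (simp only: matrix_of_matrix_vector_mul)
  moreover have "trace ((1/2) *\<^sub>R (?Q + B)) = trace (?Q + B) / 2" for B
    by (simp add: trace_def sum_divide_distrib)
  ultimately have "trace (matrix (S_sharp F m \<sigma> x)) = trace (?Q + J ** transpose ?Q ** ?G) / 2"
    by (simp only:)
  then show ?thesis
    using trace_adjoint[OF J(2), of ?Q] trace_add[of ?Q "J ** transpose ?Q ** ?G"] by simp
qed

theorem raychaudhuri:
  assumes x: "x \<in> S"
  obtains T where "((\<lambda>y. trace (matrix (P_s y))) has_derivative T) (at x)"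
    "T (\<sigma> x) = trace (matrix (S_sharp F m \<sigma> x)) - trace (matrix (P_s x) ** matrix (P_s x))"
  using trace_P_s_has_derivative[OF x] trace_S_sharp[OF x] trace_riccati[OF x] by (metis add_diff_cancel_left')

end

section \<open>Tangent spaces\<close>

text \<open>Lifts of straight lines are the smooth curves whose velocities realize all
  pushforwards.\<close>

lemma Ck_on_line:
  fixes f :: "'b::real_normed_vector \<Rightarrow> 'c::real_normed_vector"
  assumes J: "open J" and "\<And>t. t \<in> J \<Longrightarrow> x + t *\<^sub>R a \<in> S" and "Ck_on k S f"
  shows "Ck_on k J (\<lambda>t::real. f (x + t *\<^sub>R a))"
  using assms(3)
proof (induction k arbitrary: f)
  case 0
  then show ?case
    using assms(2) by (auto intro!: continuous_intros continuous_on_compose2[of S f])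
next
  case (Suc k)
  have *: "((\<lambda>t. f (x + t *\<^sub>R a)) has_derivative (\<lambda>h. h *\<^sub>R dd f (x + t *\<^sub>R a) a)) (at t)" if "t \<in> J" for t
  proof -
    have d: "f differentiable (at (x + t *\<^sub>R a))"
      using Suc.prems assms(2)[OF that] by simp
    have "((\<lambda>t. f (x + t *\<^sub>R a)) has_derivative (\<lambda>h. dd f (x + t *\<^sub>R a) (h *\<^sub>R a))) (at t)"
      using dd_works[OF d]
      by (intro has_derivative_compose[where g=f and f="\<lambda>t. x + t *\<^sub>R a"]) (auto intro!: derivative_eq_intros)
    then show ?thesis
      by (simp add: linear_cmul[OF linear_frechet_derivative[OF d]])
  qed
  have "Ck_on k J (\<lambda>t. dd (\<lambda>t. f (x + t *\<^sub>R a)) t h)" for h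
  proof (rule Ck_on_cong[OF J])
    show "Ck_on k J (\<lambda>t. h *\<^sub>R dd f (x + t *\<^sub>R a) a)"
      using Suc.IH[of "\<lambda>y. dd f y a"] Suc.prems
      by (intro Ck_on_bounded_linear[OF J bounded_linear_scaleR_right]) simp
  qed (simp add: dd_eqI[OF *])
  then show ?case
    using * by (auto simp: differentiable_def)
qed

lemma smooth_on_graph:
  assumes "open S" "smooth_on S \<sigma>"
  shows "smooth_on S (\<lambda>y. (y, \<sigma> y))"
proof -
  have "smooth_on S (\<lambda>y. (y, 0) + (0, \<sigma> y))"
    by (intro smooth_on_add[OF assms(1)] smooth_on_bounded_linear[OF assms(1) _ smooth_on_ident]
        smooth_on_bounded_linear[OF assms(1) _ assms(2), of "\<lambda>v. (0, v)"])
      (auto intro!: bounded_linear_Pair bounded_linear_ident bounded_linear_zero)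
  then show ?thesis by simp
qed

lemma pushforward_in_tangent_space:
  fixes \<sigma> :: "real ^ 'n::finite \<Rightarrow> real ^ 'n"
  assumes S: "open S" "x \<in> S" and \<sigma>: "smooth_on S \<sigma>" and T: "\<And>y. y \<in> S \<Longrightarrow> (y, \<sigma> y) \<in> T"
  shows "pushforward \<sigma> x a \<in> tangent_space T (x, \<sigma> x)"
proof -
  let ?\<gamma> = "\<lambda>t. (x + t *\<^sub>R a, \<sigma> (x + t *\<^sub>R a))"
  have "open ((\<lambda>t. x + t *\<^sub>R a) -` S)"
    by (intro continuous_open_vimage S continuous_intros)
  moreover have "0 \<in> (\<lambda>t. x + t *\<^sub>R a) -` S" using S(2) by simp
  ultimately obtain e where e: "e > 0" "ball 0 e \<subseteq> (\<lambda>t. x + t *\<^sub>R a) -` S"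
    by (rule openE)
  then have line: "x + t *\<^sub>R a \<in> S" if "t \<in> {- e<..<e}" for t
  proof -
    have "t \<in> ball 0 e" using that by (auto simp: dist_real_def)
    then show ?thesis using e(2) by blast
  qed
  have "smooth_on {- e<..<e} ?\<gamma>"
    unfolding smooth_on_def
  proof
    show "Ck_on k {- e<..<e} ?\<gamma>" for k
      by (rule Ck_on_line[where f="\<lambda>y. (y, \<sigma> y)" and S=S])
        (use line smooth_on_graph[OF S(1) \<sigma>] in \<open>auto simp: smooth_on_def\<close>)
  qed
  moreover have "(?\<gamma> has_vector_derivative pushforward \<sigma> x a) (at 0)"
  proof -
    have "((\<lambda>y. (y, \<sigma> y)) has_derivative (\<lambda>a. (a, dd \<sigma> x a))) (at (x + 0 *\<^sub>R a))"
      using smooth_on_has_derivative[OF \<sigma> S(2)]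
      by (auto intro!: has_derivative_Pair has_derivative_ident)
    then have "(?\<gamma> has_derivative (\<lambda>h. (h *\<^sub>R a, dd \<sigma> x (h *\<^sub>R a)))) (at 0)"
      by (intro has_derivative_compose[where g="\<lambda>y. (y, \<sigma> y)" and f="\<lambda>t. x + t *\<^sub>R a"])
        (auto intro!: derivative_eq_intros)
    then show ?thesis
      by (simp add: has_vector_derivative_def pushforward_def linear_cmul[OF linear_dd[OF \<sigma> S(2)]])
  qed
  moreover have "?\<gamma> ` {- e<..<e} \<subseteq> T"
    using line T by blast
  ultimately show ?thesis
    unfolding tangent_space_def using e(1) by (intro CollectI exI[of _ e] exI[of _ ?\<gamma>]) auto
qed

text \<open>The curve has inner product zero with every vector orthogonal to L, hence so does its
  velocity; L is its own double orthogonal complement.\<close>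

lemma has_vector_derivative_in_subspace:
  fixes f :: "real \<Rightarrow> 'b::euclidean_space"
  assumes L: "subspace L" and f: "(f has_vector_derivative d) (at t)"
    and ev: "eventually (\<lambda>s. f s \<in> L) (nhds t)"
  shows "d \<in> L"
proof -
  obtain U where U: "open U" "t \<in> U" "\<And>s. s \<in> U \<Longrightarrow> f s \<in> L"
    using ev unfolding eventually_nhds by blast
  have "orthogonal z d" if z: "z \<in> L\<^sup>\<bottom>" for z
  proof -
    have "((\<lambda>s. f s \<bullet> z) has_vector_derivative d \<bullet> z) (at t)"
      by (rule bounded_linear.has_vector_derivative[OF bounded_linear_inner_left f])
    moreover have "((\<lambda>s. f s \<bullet> z) has_vector_derivative 0) (at t)"
      by (rule has_vector_derivative_transform_within_open[OF has_vector_derivative_const U(1,2)])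
        (use z U(3) in \<open>auto simp: orthogonal_comp_def orthogonal_def\<close>)
    ultimately have "d \<bullet> z = 0"
      by (rule vector_derivative_unique_at)
    then show ?thesis by (simp add: orthogonal_def inner_commute)
  qed
  then have "d \<in> L\<^sup>\<bottom>\<^sup>\<bottom>" by (simp add: orthogonal_comp_def)
  then show ?thesis using orthogonal_comp_self[OF L] by simp
qed

text \<open>\<open>tangent_space\<close> is a set of velocities, not linear by definition, so it is
  enclosed in the preimage of the model subspace under the derivative of the straightening map. The
  smooth inverse makes that derivative injective and bounds the dimension.\<close>

lemma tangent_space_subspace:
  fixes S :: "'b::euclidean_space set"
  assumes "submanifold d S" "p \<in> S"
  obtains K where "subspace K" "dim K \<le> d" "tangent_space S p \<subseteq> K"
proof -
  obtain W \<Phi> and L :: "'b set" where W: "open W" "p \<in> W" and \<Phi>: "smooth_on W \<Phi>" "inj_on \<Phi> W"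
    and inv: "open (\<Phi> ` W)" "smooth_on (\<Phi> ` W) (inv_into W \<Phi>)"
    and L: "subspace L" "dim L = d" "\<Phi> ` (S \<inter> W) = \<Phi> ` W \<inter> L"
    using assms unfolding submanifold_def by metis
  note lin = linear_dd[OF \<Phi>(1) W(2)]
  define K where "K = {Y. dd \<Phi> p Y \<in> L}"
  have K: "subspace K"
    unfolding K_def using linear_subspace_vimage[OF lin L(1)] by (simp add: vimage_def)
  have "inj (dd \<Phi> p)"
  proof -
    have "(inv_into W \<Phi> has_derivative dd (inv_into W \<Phi>) (\<Phi> p)) (at (\<Phi> p))"
      using smooth_on_has_derivative[OF inv(2)] W(2) by blast
    from has_derivative_compose[OF smooth_on_has_derivative[OF \<Phi>(1) W(2)] this]
    have "((\<lambda>x. x) has_derivative (\<lambda>Y. dd (inv_into W \<Phi>) (\<Phi> p) (dd \<Phi> p Y))) (at p)"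
      by (rule has_derivative_transform_within_open[OF _ W]) (simp add: \<Phi>(2))
    then have "(\<lambda>Y. dd (inv_into W \<Phi>) (\<Phi> p) (dd \<Phi> p Y)) = (\<lambda>Y. Y)"
      using has_derivative_unique[OF _ has_derivative_ident] by blast
    then show ?thesis
      by (metis injI)
  qed
  then have "dim K = dim (dd \<Phi> p ` K)"
    using dim_image_eq[OF lin, of K] by (metis inj_on_subset subset_UNIV)
  also have "\<dots> \<le> dim L"
    by (rule dim_subset) (auto simp: K_def)
  finally have "dim K \<le> d" by (simp add: L)
  moreover have "tangent_space S p \<subseteq> K"
  proof
    fix Y assume "Y \<in> tangent_space S p"
    then obtain e \<gamma> where e: "e > 0" and \<gamma>: "smooth_on {- e<..<e} \<gamma>" "\<gamma> ` {- e<..<e} \<subseteq> S" "\<gamma> 0 = p"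
      "(\<gamma> has_vector_derivative Y) (at (0::real))"
      unfolding tangent_space_def by blast
    have "((\<lambda>t. \<Phi> (\<gamma> t)) has_derivative (\<lambda>h. dd \<Phi> p (h *\<^sub>R Y))) (at 0)"
      using has_derivative_compose[OF \<gamma>(4)[unfolded has_vector_derivative_def], of \<Phi> "dd \<Phi> p"]
        smooth_on_has_derivative[OF \<Phi>(1) W(2)] \<gamma>(3) by simp
    then have der: "((\<lambda>t. \<Phi> (\<gamma> t)) has_vector_derivative dd \<Phi> p Y) (at 0)"
      by (simp add: has_vector_derivative_def linear_cmul[OF lin])
    have "open (\<gamma> -` W \<inter> {- e<..<e})"
      using continuous_open_preimage[OF smooth_on_continuous[OF \<gamma>(1)] open_greaterThanLessThan W(1)]
      by (simp add: Int_commute)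
    then have "eventually (\<lambda>t. t \<in> \<gamma> -` W \<inter> {- e<..<e}) (nhds 0)"
      using e \<gamma>(3) W(2) by (intro eventually_nhds_in_open) auto
    moreover have "\<Phi> (\<gamma> t) \<in> L" if "t \<in> \<gamma> -` W \<inter> {- e<..<e}" for t
    proof -
      have "\<gamma> t \<in> S \<inter> W" using that \<gamma>(2) by blast
      then show ?thesis using L(3) by blast
    qed
    ultimately have "eventually (\<lambda>t. \<Phi> (\<gamma> t) \<in> L) (nhds 0)"
      by (rule eventually_mono)
    then have "dd \<Phi> p Y \<in> L"
      by (rule has_vector_derivative_in_subspace[OF L(1) der])
    then show "Y \<in> K" by (simp add: K_def)
  qed
  ultimately show thesis using K that by blast
qed

text \<open>A dimension squeeze: the range is already n-dimensional and lies in the tangent space,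
  which lies in a subspace of dimension at most n.\<close>

lemma tangent_space_eq_range_pushforward:
  fixes \<sigma> :: "real ^ 'n::finite \<Rightarrow> real ^ 'n"
  assumes S: "open S" "x \<in> S" and \<sigma>: "smooth_on S \<sigma>" and T: "\<And>y. y \<in> S \<Longrightarrow> (y, \<sigma> y) \<in> T"
    and "submanifold CARD('n) T"
  shows "tangent_space T (x, \<sigma> x) = range (pushforward \<sigma> x)"
proof
  have lin: "linear (pushforward \<sigma> x)"
    using linear_dd[OF \<sigma> S(2)] by (auto intro!: linearI simp: pushforward_def linear_add linear_cmul)
  have inj: "inj (pushforward \<sigma> x)"
    by (auto intro: injI simp: pushforward_def)
  have "dim (range (pushforward \<sigma> x)) = CARD('n)"
    using dim_image_eq[OF lin, of UNIV] inj by (simp add: inj_on_subset)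
  moreover obtain K where K: "subspace K" "dim K \<le> CARD('n)" "tangent_space T (x, \<sigma> x) \<subseteq> K"
    using tangent_space_subspace[OF assms(5)] T[OF S(2)] by metis
  moreover have *: "range (pushforward \<sigma> x) \<subseteq> tangent_space T (x, \<sigma> x)"
    using pushforward_in_tangent_space[OF S \<sigma> T] by blast
  ultimately have "range (pushforward \<sigma> x) = K"
    using subspace_dim_equal[OF linear_subspace_image[OF lin subspace_UNIV] K(1)] by auto
  then show "tangent_space T (x, \<sigma> x) \<subseteq> range (pushforward \<sigma> x)"
    using K(3) by simp
  show "range (pushforward \<sigma> x) \<subseteq> tangent_space T (x, \<sigma> x)" by (rule *)
qed

section \<open>Charts\<close>

lemma smooth_manifold_chart:
  assumes "smooth_manifold M A" "c \<in> A"
  shows "openin M (cdom c)" "inj_on (cmap c) (cdom c)"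
    "y \<in> cdom c \<Longrightarrow> cinv c (cmap c y) = y"
    "openin M V \<Longrightarrow> open (cmap c ` (V \<inter> cdom c))"
proof -
  have c: "openin M (cdom c)" "open (cmap c ` cdom c)"
    "homeomorphic_map (subtopology M (cdom c)) (top_of_set (cmap c ` cdom c)) (cmap c)"
    using assms unfolding smooth_manifold_def by auto
  then have top: "topspace (subtopology M (cdom c)) = cdom c"
    using openin_subset by fastforce
  show "openin M (cdom c)" by (rule c)
  show inj: "inj_on (cmap c) (cdom c)"
    using homeomorphic_imp_injective_map[OF c(3)] top by simp
  show "y \<in> cdom c \<Longrightarrow> cinv c (cmap c y) = y"
    by (simp add: cinv_def inj)
  assume "openin M V"
  then have "openin (subtopology M (cdom c)) (V \<inter> cdom c)"
    by (auto simp: openin_subtopology)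
  then have "openin (top_of_set (cmap c ` cdom c)) (cmap c ` (V \<inter> cdom c))"
    using homeomorphic_imp_open_map[OF c(3)] by (simp add: open_map_def)
  then show "open (cmap c ` (V \<inter> cdom c))"
    using c(2) openin_open_eq by blast
qed

lemma transition_has_derivative:
  assumes M: "smooth_manifold M A" and "c \<in> A" "d \<in> A" "y \<in> cdom c" "y \<in> cdom d"
  shows "((cmap d \<circ> cinv c) has_derivative dd (cmap d \<circ> cinv c) (cmap c y)) (at (cmap c y))"
  using assms by (intro smooth_on_has_derivative[where S = "cmap c ` (cdom c \<inter> cdom d)"])
    (auto simp: smooth_manifold_def)

lemma tvec_tscale:
  assumes M: "smooth_manifold M A" and c: "c \<in> A" and x: "x \<in> cmap c ` cdom c"
  shows "tvec A c (x, r *\<^sub>R v) = tscale r (tvec A c (x, v))"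
proof -
  obtain y where y: "y \<in> cdom c" "x = cmap c y" using x by blast
  have "dd (cmap d \<circ> cinv c) x (r *\<^sub>R v) = r *\<^sub>R dd (cmap d \<circ> cinv c) x v" if "d \<in> A" "y \<in> cdom d" for d
    using transition_has_derivative[OF M c that(1) y(1) that(2)] y(2)
    by (simp add: has_derivative_linear linear_cmul)
  then show ?thesis
    using smooth_manifold_chart(3)[OF M c y(1)] y by (auto simp: tvec_def tscale_def fun_eq_iff)
qed

text \<open>By the chain rule for transition maps, the components in the chart c determine those in
  all other charts.\<close>

lemma tvec_tcoord:
  assumes M: "smooth_manifold M A" and z: "z \<in> slit_tangent A" and c: "c \<in> A" "fst z \<in> cdom c"
  shows "tvec A c (tcoord c z) = z"
proof -
  obtain c' y v where c': "c' \<in> A" and y: "y \<in> cdom c'" and zv: "z = tvec A c' (cmap c' y, v)"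
    using z unfolding slit_tangent_def by blast
  note inv = smooth_manifold_chart(3)[OF M]
  have fz: "fst z = y" using inv[OF c' y] by (simp add: zv tvec_def)
  then have yc: "y \<in> cdom c" using c by simp
  have chain: "dd (cmap d \<circ> cinv c) (cmap c y) (dd (cmap c \<circ> cinv c') (cmap c' y) v)
     = dd (cmap d \<circ> cinv c') (cmap c' y) v" if d: "d \<in> A" "y \<in> cdom d" for d
  proof -
    let ?W = "cmap c' ` (cdom c \<inter> cdom d \<inter> cdom c')"
    have W: "open ?W" "cmap c' y \<in> ?W"
      using smooth_manifold_chart(4)[OF M c' openin_Int[OF smooth_manifold_chart(1)[OF M c(1)]
            smooth_manifold_chart(1)[OF M d(1)]]] d y yc by auto
    have cc: "(cmap c \<circ> cinv c') (cmap c' y) = cmap c y" by (simp add: inv[OF c' y])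
    from has_derivative_compose[OF transition_has_derivative[OF M c' c(1) y yc],
        of "cmap d \<circ> cinv c", unfolded cc, OF transition_has_derivative[OF M c(1) d(1) yc d(2)]]
    have "((cmap d \<circ> cinv c') has_derivative
      (\<lambda>v. dd (cmap d \<circ> cinv c) (cmap c y) (dd (cmap c \<circ> cinv c') (cmap c' y) v))) (at (cmap c' y))"
      by (rule has_derivative_transform_within_open[OF _ W]) (use inv[OF c'] inv[OF c(1)] in auto)
    from dd_eqI[OF this] show ?thesis by simp
  qed
  have tc: "tcoord c z = (cmap c y, dd (cmap c \<circ> cinv c') (cmap c' y) v)"
    using c yc inv[OF c' y] fz by (simp add: tcoord_def) (simp add: zv tvec_def)
  show ?thesis
    unfolding tc unfolding zv tvec_def using inv[OF c' y] inv[OF c(1) yc] chain by (auto simp: fun_eq_iff)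
qed

lemma cone_structure_chart:
  assumes M: "smooth_manifold M A" and C: "cone_structure M A H N G m" and c: "c \<in> A"
  shows "cone_chart (local_fun A G c) (local_set A N c) m"
proof
  show "open (local_set A N c)"
    using C c by (auto simp: cone_structure_def openin_slit_topology)
  show "smooth_on (local_set A N c) (local_fun A G c)" "m \<noteq> 1"
    "\<And>p. p \<in> local_set A N c \<Longrightarrow> det (gmat (local_fun A G c) p) \<noteq> 0"
    using C c by (auto simp: cone_structure_def)
  show "(x, r *\<^sub>R v) \<in> local_set A N c \<and>
      local_fun A G c (x, r *\<^sub>R v) = r powr m * local_fun A G c (x, v)"
    if "(x, v) \<in> local_set A N c" "r > 0" for x v r
    using that C tvec_tscale[OF M c] by (auto simp: cone_structure_def local_set_def local_fun_def)
qed

lemma sachs_section_chart: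
  fixes A :: "('a, 'n::finite) chart set"
  assumes M: "smooth_manifold M A" and C: "cone_structure M A H N G m"
    and s: "sachs_section M A H G m U s" and c: "c \<in> A"
  shows "sachs_chart (local_fun A G c) (local_set A N c) m (cmap c ` (U \<inter> cdom c)) (components c s)"
proof -
  let ?F = "local_fun A G c" and ?S = "cmap c ` (U \<inter> cdom c)" and ?\<sigma> = "components c s"
  obtain T where T: "affine_sachs_manifold M A H G m T" "s ` U \<subseteq> T"
    using s unfolding sachs_section_def by blast
  interpret cone_chart ?F "local_set A N c" m
    by (rule cone_structure_chart[OF M C c])
  have H: "T \<subseteq> H" "H \<subseteq> slit_tangent A" "H \<subseteq> N" "\<And>z. z \<in> H \<Longrightarrow> G z = 0"
    using T C by (auto simp: affine_sachs_manifold_def cone_structure_def)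
  have S: "open ?S"
    using smooth_manifold_chart(4)[OF M c] s by (simp add: sachs_section_def)
  have \<sigma>: "smooth_on ?S ?\<sigma>"
    using s c by (simp add: sachs_section_def)
  have sec: "tvec A c (x, ?\<sigma> x) \<in> T" "x \<in> cmap c ` cdom c" if "x \<in> ?S" for x
  proof -
    obtain y where y: "y \<in> U" "y \<in> cdom c" "x = cmap c y" using \<open>x \<in> ?S\<close> by blast
    have sy: "s y \<in> T" "fst (s y) = y" using s T y by (auto simp: sachs_section_def)
    have "(x, ?\<sigma> x) = tcoord c (s y)"
      using smooth_manifold_chart(3)[OF M c y(2)] sy by (simp add: tcoord_def components_def y)
    then show "tvec A c (x, ?\<sigma> x) \<in> T"
      using tvec_tcoord[OF M _ c, of "s y"] sy H y by auto
    show "x \<in> cmap c ` cdom c" using y by blast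
  qed
  then have in_T: "(x, ?\<sigma> x) \<in> local_set A T c" if "x \<in> ?S" for x
    using that by (simp add: local_set_def)
  then have in_D: "(x, ?\<sigma> x) \<in> local_set A N c" if "x \<in> ?S" for x
    using that H by (auto simp: local_set_def)
  have tan: "tangent_space (local_set A T c) (x, ?\<sigma> x) = range (pushforward ?\<sigma> x)" if "x \<in> ?S" for x
    using T(1) c by (intro tangent_space_eq_range_pushforward[OF S that \<sigma> in_T])
      (auto simp: affine_sachs_manifold_def)
  show ?thesis
  proof
    show "open ?S" "smooth_on ?S ?\<sigma>" by (fact S, fact \<sigma>)
    fix x assume x: "x \<in> ?S"
    show "(x, ?\<sigma> x) \<in> local_set A N c" by (rule in_D[OF x])
    show "?F (x, ?\<sigma> x) = 0"
      unfolding local_fun_def o_def using sec(1)[OF x] H(1) by (intro H(4)) blast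
    \<comment> \<open>A zero fibre coordinate would make \<alpha> vanish by
      \<open>hess_fibre\<close>, against DG \<noteq> 0.\<close>
    show "?\<sigma> x \<noteq> 0"
    proof
      assume "?\<sigma> x = 0"
      then have "fdv a (x, ?\<sigma> x) = 0" for a
        using hess_fibre[OF in_D[OF x], of a] bilinear_lzero[OF hess_bilinear[OF in_D[OF x]]] m by simp
      moreover have "\<exists>Y. alpha ?F (x, ?\<sigma> x) Y \<noteq> 0"
        using C c in_D[OF x] by (simp add: cone_structure_def)
      ultimately show False by (simp add: alpha_fdv[OF in_D[OF x]])
    qed
    \<comment> \<open>The horizontal part of the spray is \<sigma> x, so \<sigma> x is the only
      vector whose pushforward can be the spray.\<close>
    have "spray ?F m (x, ?\<sigma> x) \<in> range (pushforward ?\<sigma> x)"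
      using T(1) c in_T[OF x] tan[OF x] by (auto simp: affine_sachs_manifold_def)
    then show "pushforward ?\<sigma> x (?\<sigma> x) = spray ?F m (x, ?\<sigma> x)"
      by (auto simp: spray_eq in_D x pushforward_def)
    show "wedge12 (alpha ?F (x, ?\<sigma> x)) (ext_deriv (alpha ?F) (x, ?\<sigma> x))
      (pushforward ?\<sigma> x a) (pushforward ?\<sigma> x b) (pushforward ?\<sigma> x d) = 0" for a b d
      using T(1) c in_T[OF x] tan[OF x] unfolding affine_sachs_manifold_def by blast
  qed
qed

section \<open>Focusing\<close>

text \<open>Once f is negative it stays so, and 1/f grows at rate at least 1/q. It would thus reach
  zero in finite time inside the unbounded interval.\<close>

lemma riccati_inequality_nonneg:
  fixes f :: "real \<Rightarrow> real"
  assumes I: "is_interval I" "\<not> bdd_above I" and q: "q > 0"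
    and f: "\<And>t. t \<in> I \<Longrightarrow> \<exists>d. (f has_real_derivative d) (at t) \<and> (f t)\<^sup>2 \<le> - q * d"
    and t0: "t0 \<in> I"
  shows "f t0 \<ge> 0"
proof (rule ccontr)
  assume "\<not> ?thesis"
  then have neg: "f t0 < 0" by simp
  have ray: "t \<in> I" if "t0 \<le> t" for t
  proof -
    obtain t1 where "t1 \<in> I" "t < t1"
      using I(2) unfolding bdd_above_def by (meson not_le)
    then show ?thesis
      using I(1) t0 that unfolding is_interval_1 by (meson less_imp_le)
  qed
  obtain f' where f': "\<And>t. t0 \<le> t \<Longrightarrow> (f has_real_derivative f' t) (at t)"
    "\<And>t. t0 \<le> t \<Longrightarrow> (f t)\<^sup>2 \<le> - q * f' t"
    using f ray by metis
  have "f' t \<le> 0" if "t0 \<le> t" for t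
  proof -
    have "0 \<le> - q * f' t" using f'(2)[OF that] by (meson order_trans zero_le_power2)
    then show ?thesis using q by (simp add: mult_le_0_iff)
  qed
  then have "f t \<le> f t0" if "t0 \<le> t" for t
    using DERIV_nonpos_imp_nonincreasing[OF that] f'(1) by blast
  then have ft: "f t < 0" if "t0 \<le> t" for t
    using that neg by force
  define h where "h t = 1 / f t - t / q" for t
  \<comment> \<open>The time at which the line of slope 1/q starting from 1 / f t0 reaches
    zero.\<close>
  define t1 where "t1 = t0 - q / f t0"
  have t1: "t0 \<le> t1" using q neg by (simp add: t1_def divide_nonneg_neg)
  have "h t0 \<le> h t1"
  proof (rule DERIV_nonneg_imp_nondecreasing[OF t1])
    fix t assume t: "t0 \<le> t" "t \<le> t1"
    have "(h has_real_derivative - f' t / (f t)\<^sup>2 - 1 / q) (at t)"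
      unfolding h_def using ft[OF t(1)] f'(1)[OF t(1)] q
      by (auto intro!: derivative_eq_intros simp: power2_eq_square)
    moreover have "0 \<le> - f' t / (f t)\<^sup>2 - 1 / q"
      using f'(2)[OF t(1)] ft[OF t(1)] q by (simp add: field_simps)
    ultimately show "\<exists>y. (h has_real_derivative y) (at t) \<and> 0 \<le> y" by blast
  qed
  then have "0 \<le> 1 / f t1"
    using q neg by (simp add: h_def t1_def diff_divide_distrib)
  then show False using ft[OF t1] by simp
qed

theorem theorem9:
  fixes M :: "'a topology" and A :: "('a, 'n::finite) chart set"
    and H N :: "('a, 'n) tangent set" and G :: "('a, 'n) tangent \<Rightarrow> real" and m :: real
    and I :: "real set" and X :: "real \<Rightarrow> 'a"
    and U :: "'a set" and s :: "'a \<Rightarrow> ('a, 'n) tangent" and \<theta> :: "'a \<Rightarrow> real"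
  assumes "smooth_manifold M A" and "CARD('n) \<ge> 3"
    and "cone_structure M A H N G m"
    and "lorentzian_fibres A N G"
    and "open I" and "is_interval I" and "I \<noteq> {}"
    and "null_geodesic A H G m I X"
    and "\<not> bdd_above I"
    and "sachs_section M A H G m U s" and "X ` I \<subseteq> U"
    and "\<forall>t\<in>I. positive_energy_at A G m s (X t)"
    and "congruence_member M A G m s I X"
    and "divergence_on A G m U s \<theta>"
  shows "\<forall>t\<in>I. 0 \<le> \<theta> (X t)"
proof
  fix t assume "t \<in> I"
  have "\<exists>d. ((\<lambda>\<tau>. \<theta> (X \<tau>)) has_real_derivative d) (at t) \<and>
      (\<theta> (X t))\<^sup>2 \<le> - (real CARD('n) - 2) * d" if t: "t \<in> I" for t
  proof -
    have U: "openin M U" using assms(10) by (simp add: sachs_section_def)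
    then have "X t \<in> topspace M" using t assms(11) openin_subset by blast
    then obtain c where c: "c \<in> A" "X t \<in> cdom c"
      using assms(1) unfolding smooth_manifold_def by blast
    let ?F = "local_fun A G c" and ?D = "local_set A N c" and ?S = "cmap c ` (U \<inter> cdom c)"
      and ?\<sigma> = "components c s" and ?x = "cmap c (X t)"
    interpret sachs_chart ?F ?D m ?S ?\<sigma>
      by (rule sachs_section_chart[OF assms(1,3,10) c(1)])
    have x: "?x \<in> ?S" using t c assms(11) by blast
    \<comment> \<open>In every chart the positive volume density can be cancelled in
      \<open>divergence_on\<close>, so this formula holds in whichever chart was chosen around X
      t.\<close>
    have \<theta>: "\<theta> y = trace (matrix (P_s (cmap c y)))" if "y \<in> U \<inter> cdom c" for y
      using assms(14) c(1) that divergence_eq_trace[of "cmap c y"] volume_density_pos[of "cmap c y"]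
      by (auto simp: divergence_on_def)
    obtain T where T: "((\<lambda>y. trace (matrix (P_s y))) has_derivative T) (at ?x)"
      "T (?\<sigma> ?x) = trace (matrix (S_sharp ?F m ?\<sigma> ?x)) - trace (matrix (P_s ?x) ** matrix (P_s ?x))"
      using raychaudhuri[OF x] .
    have "((\<lambda>\<tau>. cmap c (X \<tau>)) has_vector_derivative ?\<sigma> ?x) (at t)"
      using assms(13) t c unfolding congruence_member_def congruence_field_eq[OF x, symmetric] by blast
    then have "((\<lambda>\<tau>. cmap c (X \<tau>)) has_derivative (\<lambda>h. h *\<^sub>R ?\<sigma> ?x)) (at t)"
      by (simp add: has_vector_derivative_def)
    from has_derivative_compose[OF this T(1)]
    have "((\<lambda>\<tau>. trace (matrix (P_s (cmap c (X \<tau>))))) has_real_derivative T (?\<sigma> ?x)) (at t)"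
      using has_derivative_linear[OF T(1)]
      by (simp add: has_field_derivative_def linear_cmul mult_commute_abs)
    \<comment> \<open>The parameters for which X stays in U and in the chart form a neighborhood of
      t on which \<theta> along X is the differentiated trace.\<close>
    moreover have "open {\<tau> \<in> I. X \<tau> \<in> U \<inter> cdom c}"
    proof -
      have "openin M (U \<inter> cdom c)"
        using U smooth_manifold_chart(1)[OF assms(1) c(1)] by blast
      then have "openin (top_of_set I) {\<tau> \<in> topspace (top_of_set I). X \<tau> \<in> U \<inter> cdom c}"
        using assms(13) openin_continuous_map_preimage unfolding congruence_member_def by blast
      then show ?thesis using assms(5) openin_open_eq by auto
    qed
    ultimately have "((\<lambda>\<tau>. \<theta> (X \<tau>)) has_real_derivative T (?\<sigma> ?x)) (at t)"
      by (rule has_field_derivative_transform_within_open) (use t c assms(11) \<theta> in auto)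
    moreover have "trace (matrix (S_sharp ?F m ?\<sigma> ?x)) \<le> 0"
      using assms(12) t c by (simp add: positive_energy_at_def)
    moreover have "(\<theta> (X t))\<^sup>2 \<le> (real CARD('n) - 2) * trace (matrix (P_s ?x) ** matrix (P_s ?x))"
      using trace_P_s_square_bound[OF x] assms(4,11) in_D[OF x] c t \<theta>[of "X t"]
      by (auto simp: lorentzian_fibres_def)
    moreover have "(real CARD('n) - 2) * trace (matrix (P_s ?x) ** matrix (P_s ?x)) \<le> - (real CARD('n) - 2) * T (?\<sigma> ?x)"
      if "trace (matrix (S_sharp ?F m ?\<sigma> ?x)) \<le> 0"
    proof -
      have "(real CARD('n) - 2) * trace (matrix (P_s ?x) ** matrix (P_s ?x)) \<le> (real CARD('n) - 2) * - T (?\<sigma> ?x)"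
        using assms(2) that T(2) by (intro mult_left_mono) auto
      then show ?thesis by (simp add: algebra_simps)
    qed
    ultimately show ?thesis by (meson order_trans)
  qed
  \<comment> \<open>The comparison constant q = n - 2 is positive because n \<ge> 3.\<close>
  then show "0 \<le> \<theta> (X t)"
    using riccati_inequality_nonneg[OF assms(6,9) _ _ \<open>t \<in> I\<close>, of "real CARD('n) - 2" "\<lambda>\<tau>. \<theta> (X \<tau>)"] assms(2)
    by simp
qed

end
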